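(* Let $G$ be a group and let $R=\bigoplus_{g\in G}R_g$ be a ring graded by $G$ such that the following two conditions hold. (i) There is a positive integer $r$ such that, for every $g\in G$, $R_g\cong (R_1)^i$ as right $R_1$-modules for some $i\in\{0,1,\dots,r\}$. (ii) The support $\mathrm{Supp}(R)$ of $R$ is amenable with respect to $G$. Then $R$ has UGN if and only if $R_1$ has UGN.
   Context: Rings, subrings and ring homomorphisms are unital; "module" means right module unless stated otherwise. A ring $S$ has unbounded generating number (UGN) if, for every positive integer $n$, there is no $S$-module epimorphism $S^n\to S^{n+1}$. For any ring $S$, $S^0$ denotes the zero module. A ring $R$ is graded by a group $G$ if there are additive subgroups $R_g$ ($g\in G$) of $R$ with $R=\bigoplus_{g\in G}R_g$ as additive groups and $R_gR_h\subseteq R_{gh}$ for all $g,h\in G$. Here $1$ is the identity of $G$; $R_1$ is a subring, called the base ring. The support of $R$ is $\mathrm{Supp}(R):=\{g\in G: R_g\neq 0\}$. A subset $X$ of a group $G$ is amenable with respect to $G$ if there is a function $\mu:\mathcal P(G)\to[0,\infty]$ such that $\mu(A\cup B)=\mu(A)+\mu(B)$ for all $A,B\subseteq G$ with $A\cap B=\emptyset$, $\mu(gA)=\mu(A)$ for all $A\subseteq G$ and $g\in G$, and $\mu(X)=1$. *)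

theory Defs
  imports "HOL-Algebra.Algebra" "HOL-Library.Extended_Nonnegative_Real"
begin

section \<open>Right modules over noncommutative rings\<close>

text \<open>The locale module of HOL-Algebra covers commutative rings only. We reuse its record type:
  for a right module \<^term>\<open>M\<close>, the term \<^term>\<open>module.smult M s x\<close> stands for the right action
  of the scalar \<open>s\<close> on \<open>x\<close>, usually written \<open>x s\<close> (see \<open>smult_assoc\<close>).\<close>

locale right_module = S?: ring S + M?: abelian_group M
  for S :: "('s, 'k) ring_scheme" (structure) and M :: "('s, 'a, 'n) module_scheme" (structure) +
  assumes smult_closed: "\<lbrakk>s \<in> carrier S; x \<in> carrier M\<rbrakk> \<Longrightarrow> s \<odot>\<^bsub>M\<^esub> x \<in> carrier M"
    and smult_l_distr: "\<lbrakk>s \<in> carrier S; t \<in> carrier S; x \<in> carrier M\<rbrakk>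
      \<Longrightarrow> (s \<oplus>\<^bsub>S\<^esub> t) \<odot>\<^bsub>M\<^esub> x = s \<odot>\<^bsub>M\<^esub> x \<oplus>\<^bsub>M\<^esub> t \<odot>\<^bsub>M\<^esub> x"
    and smult_r_distr: "\<lbrakk>s \<in> carrier S; x \<in> carrier M; y \<in> carrier M\<rbrakk>
      \<Longrightarrow> s \<odot>\<^bsub>M\<^esub> (x \<oplus>\<^bsub>M\<^esub> y) = s \<odot>\<^bsub>M\<^esub> x \<oplus>\<^bsub>M\<^esub> s \<odot>\<^bsub>M\<^esub> y"
    and smult_assoc: "\<lbrakk>s \<in> carrier S; t \<in> carrier S; x \<in> carrier M\<rbrakk>
      \<Longrightarrow> (s \<otimes>\<^bsub>S\<^esub> t) \<odot>\<^bsub>M\<^esub> x = t \<odot>\<^bsub>M\<^esub> (s \<odot>\<^bsub>M\<^esub> x)"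
    and smult_one: "x \<in> carrier M \<Longrightarrow> \<one>\<^bsub>S\<^esub> \<odot>\<^bsub>M\<^esub> x = x"

definition right_module_hom :: "('s, 'k) ring_scheme \<Rightarrow> ('s, 'a, 'm) module_scheme
    \<Rightarrow> ('s, 'b, 'n) module_scheme \<Rightarrow> ('a \<Rightarrow> 'b) set" where
  "right_module_hom S M N = {f \<in> hom (add_monoid M) (add_monoid N).
     \<forall>s\<in>carrier S. \<forall>x\<in>carrier M. f (s \<odot>\<^bsub>M\<^esub> x) = s \<odot>\<^bsub>N\<^esub> f x}"

definition right_module_epi :: "('s, 'k) ring_scheme \<Rightarrow> ('s, 'a, 'm) module_scheme
    \<Rightarrow> ('s, 'b, 'n) module_scheme \<Rightarrow> ('a \<Rightarrow> 'b) set" where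
  "right_module_epi S M N = {f \<in> right_module_hom S M N. f ` carrier M = carrier N}"

definition right_module_iso :: "('s, 'k) ring_scheme \<Rightarrow> ('s, 'a, 'm) module_scheme
    \<Rightarrow> ('s, 'b, 'n) module_scheme \<Rightarrow> ('a \<Rightarrow> 'b) set" where
  "right_module_iso S M N = {f \<in> right_module_hom S M N. bij_betw f (carrier M) (carrier N)}"

text \<open>The fields \<open>monoid.mult\<close> and \<open>one\<close> are inherited from the ring record and
  carry no meaning for a module.\<close>

definition free_right_module :: "('s, 'k) ring_scheme \<Rightarrow> nat \<Rightarrow> ('s, nat \<Rightarrow> 's) module" where
  "free_right_module S n = \<lparr>carrier = {..<n} \<rightarrow>\<^sub>E carrier S,
     monoid.mult = undefined, one = undefined,
     ring.zero = (\<lambda>i\<in>{..<n}. \<zero>\<^bsub>S\<^esub>),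
     ring.add = (\<lambda>x y. \<lambda>i\<in>{..<n}. x i \<oplus>\<^bsub>S\<^esub> y i),
     module.smult = (\<lambda>s x. \<lambda>i\<in>{..<n}. x i \<otimes>\<^bsub>S\<^esub> s)\<rparr>"

definition UGN :: "('s, 'k) ring_scheme \<Rightarrow> bool" where
  "UGN S \<longleftrightarrow>
     (\<forall>n>0. right_module_epi S (free_right_module S n) (free_right_module S (n + 1)) = {})"

lemma (in ring) free_right_module: "right_module R (free_right_module R n)"
proof -
  let ?F = "free_right_module R n"
  interpret F: abelian_group ?F
  proof (rule abelian_groupI)
    fix x assume x: "x \<in> carrier ?F"
    show "\<exists>y\<in>carrier ?F. y \<oplus>\<^bsub>?F\<^esub> x = \<zero>\<^bsub>?F\<^esub>"
      by (rule bexI[of _ "\<lambda>i\<in>{..<n}. \<ominus> x i"])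
        (use x in \<open>auto simp: free_right_module_def l_neg PiE_iff intro!: restrict_ext\<close>)
  qed (auto simp: free_right_module_def PiE_iff a_ac extensional_def fun_eq_iff)
  show ?thesis
    by unfold_locales
      (auto simp: free_right_module_def PiE_iff extensional_def fun_eq_iff l_distr r_distr m_assoc)
qed

section \<open>Group-graded rings\<close>

locale graded_ring = G?: group G + R?: ring R
  for G :: "('g, 'm) monoid_scheme" (structure) and R :: "('a, 'n) ring_scheme" (structure)
    and A :: "'g \<Rightarrow> 'a set" +
  assumes component_additive_subgroup: "g \<in> carrier G \<Longrightarrow> additive_subgroup (A g) R"
    and direct_sum: "x \<in> carrier R \<Longrightarrow>
      \<exists>!f. f \<in> (\<Pi>\<^sub>E g\<in>carrier G. A g) \<and> finite {g \<in> carrier G. f g \<noteq> \<zero>\<^bsub>R\<^esub>}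
        \<and> x = finsum R f {g \<in> carrier G. f g \<noteq> \<zero>\<^bsub>R\<^esub>}"
    and component_mult: "\<lbrakk>g \<in> carrier G; h \<in> carrier G; x \<in> A g; y \<in> A h\<rbrakk>
      \<Longrightarrow> x \<otimes>\<^bsub>R\<^esub> y \<in> A (g \<otimes>\<^bsub>G\<^esub> h)"

definition base_ring :: "('g, 'm) monoid_scheme \<Rightarrow> ('a, 'n) ring_scheme \<Rightarrow> ('g \<Rightarrow> 'a set)
    \<Rightarrow> ('a, 'n) ring_scheme" where
  "base_ring G R A = R\<lparr>carrier := A \<one>\<^bsub>G\<^esub>\<rparr>"

text \<open>The component at \<open>g\<close> as a right module over the base ring, acting by right
  multiplication in \<open>R\<close>.\<close>

definition component_module :: "('a, 'n) ring_scheme \<Rightarrow> ('g \<Rightarrow> 'a set) \<Rightarrow> 'g \<Rightarrow> ('a, 'a) module" where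
  "component_module R A g = \<lparr>carrier = A g, monoid.mult = undefined, one = undefined,
     ring.zero = \<zero>\<^bsub>R\<^esub>, ring.add = (\<oplus>\<^bsub>R\<^esub>), module.smult = (\<lambda>s x. x \<otimes>\<^bsub>R\<^esub> s)\<rparr>"

definition graded_support :: "('g, 'm) monoid_scheme \<Rightarrow> ('a, 'n) ring_scheme \<Rightarrow> ('g \<Rightarrow> 'a set)
    \<Rightarrow> 'g set" where
  "graded_support G R A = {g \<in> carrier G. A g \<noteq> {\<zero>\<^bsub>R\<^esub>}}"

context graded_ring
begin

lemma component_sub: "g \<in> carrier G \<Longrightarrow> x \<in> A g \<Longrightarrow> x \<in> carrier R"
  using component_additive_subgroup additive_subgroup.a_subset by blast

lemma component_zero: "g \<in> carrier G \<Longrightarrow> \<zero>\<^bsub>R\<^esub> \<in> A g"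
  using component_additive_subgroup additive_subgroup.zero_closed by blast

lemma decomposition_unique:
  assumes T: "finite T" "T \<subseteq> carrier G"
    and u: "\<And>g. g \<in> T \<Longrightarrow> u g \<in> A g" and v: "\<And>g. g \<in> T \<Longrightarrow> v g \<in> A g"
    and eq: "finsum R u T = finsum R v T" and g: "g \<in> T"
  shows "u g = v g"
proof -
  let ?ext = "\<lambda>w. \<lambda>g\<in>carrier G. if g \<in> T then w g else \<zero>\<^bsub>R\<^esub>"
  let ?P = "\<lambda>x f. f \<in> (\<Pi>\<^sub>E g\<in>carrier G. A g) \<and> finite {g \<in> carrier G. f g \<noteq> \<zero>\<^bsub>R\<^esub>}
        \<and> x = finsum R f {g \<in> carrier G. f g \<noteq> \<zero>\<^bsub>R\<^esub>}"
  have P: "?P (finsum R w T) (?ext w)" if w: "\<And>g. g \<in> T \<Longrightarrow> w g \<in> A g" for w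
  proof (intro conjI)
    show "?ext w \<in> (\<Pi>\<^sub>E g\<in>carrier G. A g)"
      using w component_zero by auto
    have sub: "{g \<in> carrier G. ?ext w g \<noteq> \<zero>\<^bsub>R\<^esub>} \<subseteq> T"
      by (auto split: if_splits)
    then show "finite {g \<in> carrier G. ?ext w g \<noteq> \<zero>\<^bsub>R\<^esub>}"
      using T(1) finite_subset by blast
    have "finsum R (?ext w) {g \<in> carrier G. ?ext w g \<noteq> \<zero>\<^bsub>R\<^esub>} = finsum R w T"
      by (rule R.add.finprod_mono_neutral_cong_left[OF T(1) sub])
        (use T(2) w component_sub in \<open>auto simp: subset_iff\<close>)
    then show "finsum R w T = finsum R (?ext w) {g \<in> carrier G. ?ext w g \<noteq> \<zero>\<^bsub>R\<^esub>}" ..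
  qed
  have "finsum R u T \<in> carrier R"
    using T(2) u component_sub by (intro R.finsum_closed) (auto simp: subset_iff)
  from direct_sum[OF this] P[OF u] P[OF v, folded eq] have "?ext u = ?ext v"
    by blast
  from fun_cong[OF this, of g] show ?thesis
    using g T(2) by auto
qed

lemma one_in_base: "\<one>\<^bsub>R\<^esub> \<in> A \<one>\<^bsub>G\<^esub>"
proof -
  obtain e where e: "e \<in> (\<Pi>\<^sub>E g\<in>carrier G. A g)"
    and fin: "finite {g \<in> carrier G. e g \<noteq> \<zero>\<^bsub>R\<^esub>}"
    and sum_e: "\<one>\<^bsub>R\<^esub> = finsum R e {g \<in> carrier G. e g \<noteq> \<zero>\<^bsub>R\<^esub>}"
    using direct_sum[OF R.one_closed] by blast
  define S where "S = insert \<one>\<^bsub>G\<^esub> {g \<in> carrier G. e g \<noteq> \<zero>\<^bsub>R\<^esub>}"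
  have S: "finite S" "S \<subseteq> carrier G"
    using fin by (auto simp: S_def)
  have eA: "e g \<in> A g" if "g \<in> carrier G" for g
    using e that by auto
  have eR: "e g \<in> carrier R" if "g \<in> carrier G" for g
    using eA component_sub that by blast
  have sum_S: "finsum R e S = \<one>\<^bsub>R\<^esub>"
    unfolding sum_e
    by (rule R.add.finprod_mono_neutral_cong_right)
      (use S eR in \<open>auto simp: S_def\<close>)
  have left_unit: "e \<one>\<^bsub>G\<^esub> \<otimes>\<^bsub>R\<^esub> a = a" if h: "h \<in> carrier G" and a: "a \<in> A h" for h a
  proof -
    let ?u = "\<lambda>k. e (k \<otimes>\<^bsub>G\<^esub> inv\<^bsub>G\<^esub> h) \<otimes>\<^bsub>R\<^esub> a"
    let ?v = "\<lambda>k. if h = k then a else \<zero>\<^bsub>R\<^esub>"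
    let ?T = "(\<lambda>g. g \<otimes>\<^bsub>G\<^esub> h) ` S"
    have aR: "a \<in> carrier R"
      using component_sub h a by blast
    have T: "finite ?T" "?T \<subseteq> carrier G"
      using S h by auto
    have hT: "h \<in> ?T"
      using h by (auto simp: S_def image_iff)
    have inj: "inj_on (\<lambda>g. g \<otimes>\<^bsub>G\<^esub> h) S"
      using S(2) h by (auto simp: inj_on_def subset_iff)
    have "finsum R ?u ?T = finsum R (\<lambda>g. ?u (g \<otimes>\<^bsub>G\<^esub> h)) S"
      by (rule R.finsum_reindex[OF _ inj]) (use S(2) h aR eR in auto)
    also have "\<dots> = finsum R (\<lambda>g. e g \<otimes>\<^bsub>R\<^esub> a) S"
      by (rule R.finsum_cong') (use S(2) h aR eR in \<open>auto simp: subset_iff G.m_assoc\<close>)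
    also have "\<dots> = finsum R e S \<otimes>\<^bsub>R\<^esub> a"
      by (rule R.finsum_ldistr[symmetric]) (use S aR eR in auto)
    also have "\<dots> = finsum R ?v ?T"
      using R.finsum_singleton[OF hT T(1), of "\<lambda>_. a"] aR sum_S by simp
    finally have eq: "finsum R ?u ?T = finsum R ?v ?T" .
    have "?u h = ?v h"
    proof (rule decomposition_unique[OF T _ _ eq hT])
      fix k assume "k \<in> ?T"
      then have k: "k \<in> carrier G" using T by blast
      show "?v k \<in> A k"
        using a k component_zero by auto
      have "?u k \<in> A (k \<otimes>\<^bsub>G\<^esub> inv\<^bsub>G\<^esub> h \<otimes>\<^bsub>G\<^esub> h)"
        using k h a eA by (intro component_mult) auto
      then show "?u k \<in> A k"
        using k h by (simp add: G.m_assoc)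
    qed
    then show ?thesis
      using h by simp
  qed
  have "e \<one>\<^bsub>G\<^esub> = e \<one>\<^bsub>G\<^esub> \<otimes>\<^bsub>R\<^esub> finsum R e S"
    using sum_S eR by simp
  also have "\<dots> = finsum R (\<lambda>g. e \<one>\<^bsub>G\<^esub> \<otimes>\<^bsub>R\<^esub> e g) S"
    by (rule R.finsum_rdistr) (use S eR in auto)
  also have "\<dots> = finsum R e S"
    by (rule R.finsum_cong') (use S eR eA left_unit in \<open>auto simp: subset_iff\<close>)
  finally show ?thesis
    using sum_S eA[of "\<one>\<^bsub>G\<^esub>"] by simp
qed

lemma base_subring: "subring (A \<one>\<^bsub>G\<^esub>) R"
proof -
  interpret B: additive_subgroup "A \<one>\<^bsub>G\<^esub>" R
    by (simp add: component_additive_subgroup)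
  show ?thesis
    using B.a_subset one_in_base B.a_closed
      additive_subgroup.a_inv_closed[OF B.additive_subgroup_axioms]
      component_mult[of "\<one>\<^bsub>G\<^esub>" "\<one>\<^bsub>G\<^esub>"]
    by (intro R.subringI) auto
qed

lemma ring_base_ring: "ring (base_ring G R A)"
  unfolding base_ring_def using base_subring by (rule R.subring_is_ring)

lemma component_right_module:
  assumes g: "g \<in> carrier G"
  shows "right_module (base_ring G R A) (component_module R A g)"
proof -
  let ?M = "component_module R A g"
  interpret C: additive_subgroup "A g" R
    using g by (rule component_additive_subgroup)
  interpret B: ring "base_ring G R A"
    by (rule ring_base_ring)
  have neg: "\<ominus>\<^bsub>R\<^esub> x \<in> A g" if "x \<in> A g" for x
    using additive_subgroup.a_inv_closed[OF C.additive_subgroup_axioms that] .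
  have sub: "x \<in> carrier R" if "x \<in> A g" for x
    using component_sub g that by blast
  have sub1: "x \<in> carrier R" if "x \<in> A \<one>\<^bsub>G\<^esub>" for x
    using component_sub that by blast
  interpret M: abelian_group ?M
  proof (rule abelian_groupI)
    fix x assume x: "x \<in> carrier ?M"
    show "\<exists>y\<in>carrier ?M. y \<oplus>\<^bsub>?M\<^esub> x = \<zero>\<^bsub>?M\<^esub>"
      by (rule bexI[of _ "\<ominus>\<^bsub>R\<^esub> x"])
        (use x neg sub in \<open>auto simp: component_module_def R.l_neg\<close>)
  qed (auto simp: component_module_def sub R.a_ac)
  have act: "x \<otimes>\<^bsub>R\<^esub> s \<in> A g" if "s \<in> A \<one>\<^bsub>G\<^esub>" "x \<in> A g" for s x
    using component_mult[OF g G.one_closed that(2,1)] g by simp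
  show ?thesis
    by unfold_locales
      (auto simp: component_module_def base_ring_def act sub sub1 R.l_distr R.r_distr R.m_assoc)
qed

end

section \<open>Amenable subsets of groups\<close>

definition amenable_wrt :: "('g, 'm) monoid_scheme \<Rightarrow> 'g set \<Rightarrow> bool" where
  "amenable_wrt G E \<longleftrightarrow> E \<subseteq> carrier G \<and>
     (\<exists>\<mu> :: 'g set \<Rightarrow> ennreal.
        (\<forall>A B. A \<subseteq> carrier G \<longrightarrow> B \<subseteq> carrier G \<longrightarrow> A \<inter> B = {} \<longrightarrow> \<mu> (A \<union> B) = \<mu> A + \<mu> B) \<and>
        (\<forall>A g. A \<subseteq> carrier G \<longrightarrow> g \<in> carrier G \<longrightarrow> \<mu> (g <#\<^bsub>G\<^esub> A) = \<mu> A) \<and>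
        \<mu> E = 1)"

end

theory Submission
  imports Defs
begin

text \<open>
  An epimorphism of finitely generated free modules splits, so a ring \<open>S\<close> fails to have the unbounded
  generating number (UGN) iff \<open>P Q = 1\<close> for some matrices over \<open>S\<close> such that \<open>P\<close> has at least one
  column and more rows than columns. Such matrices over the base ring are also matrices over \<open>R\<close>,
  whence one direction.

  Conversely, suppose that \<open>R\<close> does not have UGN although the base ring \<open>R\<^sub>1\<close> does. Then for some
  \<open>n > 0\<close> there are \<open>P\<close> and \<open>Q\<close> over \<open>R\<close> with \<open>P Q = 1\<close> where \<open>P\<close> has \<open>n\<close> columns and as many rows as
  desired, say \<open>2 n r\<close>. Let \<open>K\<close> be the finite set of degrees in the entries of \<open>Q\<close>, let \<open>X\<close> be the
  support of \<open>R\<close>, and for finite \<open>F \<subseteq> X\<close> write \<open>R\<^sub>F\<close> for the sum of the components with degree in \<open>F\<close>,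
  a free right \<open>R\<^sub>1\<close>-module whose rank lies between \<open>card F\<close> and \<open>r * card F\<close>. As \<open>Q\<close> maps vectors
  over \<open>R\<^sub>F\<close> to vectors over the sum of the components in \<open>K F \<inter> X\<close>, the map \<open>P\<close>, followed by the
  projection to the degrees in \<open>F\<close>, is an epimorphism of free \<open>R\<^sub>1\<close>-modules from \<open>n\<close> copies of the
  latter onto \<open>2 n r\<close> copies of \<open>R\<^sub>F\<close>. Since \<open>R\<^sub>1\<close> has UGN, the ranks satisfy
  \<open>2 n r * card F \<le> n r * card (K F \<inter> X)\<close>, that is, \<open>2 * card F \<le> card (K F \<inter> X)\<close>
  (lemma \<open>support_doubling\<close>).

  This is Hall's condition for two disjoint injections of \<open>X\<close> into \<open>X\<close> that send each \<open>x\<close> into \<open>K x\<close>.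
  By the marriage theorem they exist. They are piecewise left translations, so they preserve any
  invariant finitely additive measure, and a set of measure 1 would contain two disjoint sets of
  measure 1 (lemma \<open>amenable_no_doubling\<close>).
\<close>

section \<open>The marriage theorem for infinite families\<close>

text \<open>The edges \<open>E\<close> relate each \<open>i \<in> I\<close> to finitely many candidates, \<open>I\<close> may be infinite.
  The proof is Rado's: by Zorn's lemma delete a maximal set of edges that preserves Hall's
  condition; submodularity of the cardinality then leaves exactly one edge at each \<open>i\<close>.\<close>
lemma marriage_theorem:
  fixes E :: "('i \<times> 'y) set"
  assumes fin: "\<And>i. i \<in> I \<Longrightarrow> finite (E `` {i})"
    and hall: "\<And>J. J \<subseteq> I \<Longrightarrow> finite J \<Longrightarrow> card J \<le> card (E `` J)"
  shows "\<exists>f. inj_on f I \<and> (\<forall>i\<in>I. (i, f i) \<in> E)"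
proof -
  define H where "H E' \<longleftrightarrow> (\<forall>J\<subseteq>I. finite J \<longrightarrow> card J \<le> card (E' `` J))" for E' :: "('i \<times> 'y) set"
  have finE: "finite (E `` J)" if "J \<subseteq> I" "finite J" for J
  proof -
    have "E `` J = (\<Union>i\<in>J. E `` {i})" by blast
    then show ?thesis using that fin by auto
  qed
  have "\<exists>M\<in>{D. H (E - D)}. \<forall>D\<in>{D. H (E - D)}. M \<subseteq> D \<longrightarrow> D = M"
  proof (rule subset_Zorn_nonempty)
    have "H (E - {})" using hall by (simp add: H_def)
    then show "{D. H (E - D)} \<noteq> {}" by blast
  next
    fix \<C> assume ne: "\<C> \<noteq> {}" and ch: "subset.chain {D. H (E - D)} \<C>"
    have "card J \<le> card ((E - \<Union>\<C>) `` J)" if J: "J \<subseteq> I" "finite J" for J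
    proof -
      \<comment> \<open>Only finitely many edges start in \<open>J\<close>, so one member of the chain already deletes
        all of those that the union deletes.\<close>
      let ?W = "E \<inter> J \<times> UNIV"
      have "?W \<subseteq> J \<times> E `` J" by auto
      then have "finite ?W"
        using J finE[OF J] by (meson finite_SigmaI finite_subset)
      then obtain D where D: "D \<in> \<C>" "\<Union>\<C> \<inter> ?W \<subseteq> D"
        using finite_subset_Union_chain[of "\<Union>\<C> \<inter> ?W" \<C>] ne ch by blast
      then have "(E - \<Union>\<C>) `` J = (E - D) `` J" by blast
      moreover have "H (E - D)" using D ch by (auto simp: subset.chain_def)
      ultimately show ?thesis using J by (simp add: H_def)
    qed
    then show "\<Union>\<C> \<in> {D. H (E - D)}" by (simp add: H_def)
  qed
  then obtain M where M: "H (E - M)" and max: "\<And>D. H (E - D) \<Longrightarrow> M \<subseteq> D \<Longrightarrow> D = M"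
    by blast
  define T where "T = E - M"
  have T: "card J \<le> card (T `` J)" if "J \<subseteq> I" "finite J" for J
    using M that by (simp add: H_def T_def)
  have finT: "finite (T `` J)" if "J \<subseteq> I" "finite J" for J
    by (rule finite_subset[OF _ finE[OF that]]) (auto simp: T_def)
  \<comment> \<open>By minimality every edge of \<open>T\<close> is critical for some set containing its origin.\<close>
  have critical: "\<exists>L. L \<subseteq> I \<and> finite L \<and> i \<notin> L \<and> card ((T - {(i, y)}) `` insert i L) \<le> card L"
    if i: "i \<in> I" and y: "(i, y) \<in> T" for i y
  proof -
    have "\<not> H (E - insert (i, y) M)"
      using max[of "insert (i, y) M"] y by (auto simp: T_def)
    moreover have "E - insert (i, y) M = T - {(i, y)}"
      by (auto simp: T_def)
    ultimately obtain J where J: "J \<subseteq> I" "finite J" and less: "card ((T - {(i, y)}) `` J) < card J"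
      unfolding H_def by (metis linorder_not_le)
    have iJ: "i \<in> J"
    proof (rule ccontr)
      assume "i \<notin> J"
      then have "(T - {(i, y)}) `` J = T `` J" by blast
      with less T[OF J] show False by simp
    qed
    then have "insert i (J - {i}) = J" by blast
    moreover have "card (J - {i}) = card J - 1"
      using iJ J by simp
    ultimately show ?thesis
      using J less by (intro exI[of _ "J - {i}"]) auto
  qed
  \<comment> \<open>For two edges at \<open>i\<close> with critical sets \<open>insert i L\<close> and \<open>insert i L'\<close>, Hall's condition for
    \<open>insert i (L \<union> L')\<close> and \<open>L \<inter> L'\<close> contradicts the modularity of the cardinality.\<close>
  have unique: "y = z" if i: "i \<in> I" and y: "(i, y) \<in> T" and z: "(i, z) \<in> T" for i y z
  proof (rule ccontr)
    assume neq: "y \<noteq> z"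
    obtain L where L: "L \<subseteq> I" "finite L" "i \<notin> L"
      and cL: "card ((T - {(i, y)}) `` insert i L) \<le> card L"
      using critical[OF i y] by blast
    obtain L' where L': "L' \<subseteq> I" "finite L'" "i \<notin> L'"
      and cL': "card ((T - {(i, z)}) `` insert i L') \<le> card L'"
      using critical[OF i z] by blast
    let ?B = "(T - {(i, y)}) `` insert i L" and ?C = "(T - {(i, z)}) `` insert i L'"
    have "?B \<subseteq> T `` insert i L" "?C \<subseteq> T `` insert i L'"
      by blast+
    then have finBC: "finite ?B" "finite ?C"
      using finT[of "insert i L"] finT[of "insert i L'"] L L' i by (auto elim: finite_subset)
    have "T `` insert i (L \<union> L') \<subseteq> ?B \<union> ?C"
      using neq by auto
    then have "card (T `` insert i (L \<union> L')) \<le> card (?B \<union> ?C)"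
      using finBC by (intro card_mono) auto
    moreover have "card (insert i (L \<union> L')) \<le> card (T `` insert i (L \<union> L'))"
      using L L' i by (intro T) auto
    moreover have "card (insert i (L \<union> L')) = Suc (card (L \<union> L'))"
      using L L' by simp
    ultimately have 1: "Suc (card (L \<union> L')) \<le> card (?B \<union> ?C)" by simp
    have "T `` (L \<inter> L') \<subseteq> ?B \<inter> ?C"
      using L L' by auto
    then have "card (T `` (L \<inter> L')) \<le> card (?B \<inter> ?C)"
      using finBC by (intro card_mono) auto
    moreover have "card (L \<inter> L') \<le> card (T `` (L \<inter> L'))"
      using L L' by (intro T) auto
    ultimately have 2: "card (L \<inter> L') \<le> card (?B \<inter> ?C)" by simp
    show False
      using 1 2 cL cL' card_Un_Int[OF finBC] card_Un_Int[OF L(2) L'(2)] by linarith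
  qed
  have "\<exists>y. (i, y) \<in> T" if "i \<in> I" for i
    using T[of "{i}"] that by (auto simp: card_eq_0_iff Suc_le_eq card_gt_0_iff)
  then obtain f where f: "\<And>i. i \<in> I \<Longrightarrow> (i, f i) \<in> T"
    by metis
  have "inj_on f I"
  proof (rule inj_onI)
    fix i j assume ij: "i \<in> I" "j \<in> I" "f i = f j"
    have "T `` {i, j} \<subseteq> {f i}"
      using unique[OF ij(1) _ f[OF ij(1)]] unique[OF ij(2) _ f[OF ij(2)]] ij(3) by auto
    then have "card (T `` {i, j}) \<le> card {f i}"
      by (intro card_mono) simp_all
    with T[of "{i, j}"] ij show "i = j"
      by (cases "i = j") simp_all
  qed
  moreover have "(i, f i) \<in> E" if "i \<in> I" for i
    using f[OF that] by (simp add: T_def)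
  ultimately show ?thesis by blast
qed

section \<open>Amenable subsets do not double\<close>

context group
begin

text \<open>A map that moves points only by left multiplication with elements of a finite set is piecewise
  a translation, with finitely many pieces.\<close>
lemma invariant_measure_image:
  fixes \<mu> :: "'a set \<Rightarrow> ennreal"
  assumes add: "\<And>A B. A \<subseteq> carrier G \<Longrightarrow> B \<subseteq> carrier G \<Longrightarrow> A \<inter> B = {} \<Longrightarrow> \<mu> (A \<union> B) = \<mu> A + \<mu> B"
    and inv: "\<And>A g. A \<subseteq> carrier G \<Longrightarrow> g \<in> carrier G \<Longrightarrow> \<mu> (g <# A) = \<mu> A"
    and empty: "\<mu> {} = 0"
    and K: "finite K" "K \<subseteq> carrier G"
    and Y: "Y \<subseteq> carrier G" and inj: "inj_on f Y"
    and f: "\<And>x. x \<in> Y \<Longrightarrow> \<exists>k\<in>K. f x = k \<otimes> x"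
  shows "\<mu> (f ` Y) = \<mu> Y"
  using K Y inj f
proof (induction K arbitrary: Y rule: finite_induct)
  case empty
  then have "Y = {}" by auto
  then show ?case by simp
next
  case (insert k K)
  let ?V = "{x \<in> Y. f x = k \<otimes> x}" and ?Z = "{x \<in> Y. f x \<noteq> k \<otimes> x}"
  have decomp: "Y = ?V \<union> ?Z" by blast
  have "f x \<in> carrier G" if "x \<in> Y" for x
    using insert.prems(1,2) insert.prems(4)[OF that] that by (auto simp: subset_iff)
  then have fX: "f ` Y \<subseteq> carrier G" by blast
  have "f ` ?V = k <# ?V"
    by (auto simp: l_coset_def image_iff)
  then have V: "\<mu> (f ` ?V) = \<mu> ?V"
    using inv[of ?V k] insert.prems by auto
  have Z: "\<mu> (f ` ?Z) = \<mu> ?Z"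
  proof (rule insert.IH)
    show "inj_on f ?Z" by (rule inj_on_subset[OF insert.prems(3)]) auto
    show "\<exists>k\<in>K. f x = k \<otimes> x" if "x \<in> ?Z" for x
      using insert.prems(4)[of x] that by blast
  qed (use insert.prems in auto)
  have "f ` ?V \<inter> f ` ?Z = {}"
    using insert.prems(3) unfolding inj_on_def by (safe; metis)
  then have "\<mu> (f ` ?V \<union> f ` ?Z) = \<mu> (f ` ?V) + \<mu> (f ` ?Z)"
    using fX by (intro add) auto
  also have "\<dots> = \<mu> ?V + \<mu> ?Z" by (simp only: V Z)
  also have "\<dots> = \<mu> (?V \<union> ?Z)"
    using insert.prems(2) by (intro add[symmetric]) auto
  finally show ?case
    by (simp only: image_Un[symmetric] decomp[symmetric])
qed

text \<open>The doubling condition is Hall's condition for matching \<open>Y \<times> UNIV\<close>, two copies of \<open>Y\<close>, into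
  \<open>Y\<close> along the edges from \<open>x\<close> to \<open>K x\<close>. A matching embeds two disjoint sets of measure 1
  into \<open>Y\<close>, which itself has measure 1.\<close>
lemma amenable_no_doubling:
  assumes Y: "amenable_wrt G Y" and K: "finite K" "K \<subseteq> carrier G"
    and dbl: "\<And>F. finite F \<Longrightarrow> F \<subseteq> Y \<Longrightarrow> 2 * card F \<le> card ((K <#> F) \<inter> Y)"
  shows False
proof -
  obtain \<mu> :: "'a set \<Rightarrow> ennreal" where YG: "Y \<subseteq> carrier G"
    and add: "\<And>A B. A \<subseteq> carrier G \<Longrightarrow> B \<subseteq> carrier G \<Longrightarrow> A \<inter> B = {} \<Longrightarrow> \<mu> (A \<union> B) = \<mu> A + \<mu> B"
    and inv: "\<And>A g. A \<subseteq> carrier G \<Longrightarrow> g \<in> carrier G \<Longrightarrow> \<mu> (g <# A) = \<mu> A"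
    and one: "\<mu> Y = 1"
    using Y unfolding amenable_wrt_def by metis
  define E where "E = {((x, b :: bool), y). y \<in> (K <#> {x}) \<inter> Y}"
  have EJ: "E `` J = (K <#> fst ` J) \<inter> Y" for J
    by (force simp: E_def set_mult_def)
  have "\<exists>f. inj_on f (Y \<times> UNIV) \<and> (\<forall>i\<in>Y \<times> UNIV. (i, f i) \<in> E)"
  proof (rule marriage_theorem[of "Y \<times> UNIV" E])
    fix i :: "'a \<times> bool"
    have "finite (K <#> {fst i})"
      using K by (auto simp: set_mult_def)
    then show "finite (E `` {i})" by (simp add: EJ)
  next
    fix J :: "('a \<times> bool) set" assume J: "J \<subseteq> Y \<times> UNIV" "finite J"
    have "J \<subseteq> fst ` J \<times> UNIV" by force
    then have "card J \<le> card (fst ` J \<times> (UNIV :: bool set))"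
      using J(2) by (intro card_mono) auto
    also have "\<dots> = 2 * card (fst ` J)" by (simp add: card_cartesian_product)
    also have "\<dots> \<le> card (E `` J)"
      unfolding EJ using J by (intro dbl) auto
    finally show "card J \<le> card (E `` J)" .
  qed
  then obtain f where f: "inj_on f (Y \<times> UNIV)" and fE: "\<And>i. i \<in> Y \<times> UNIV \<Longrightarrow> (i, f i) \<in> E"
    by blast
  let ?f = "\<lambda>b x. f (x, b)"
  \<comment> \<open>Additivity alone allows \<open>\<mu> {} = \<infinity>\<close>; the finite value \<open>\<mu> Y = 1\<close> excludes this.\<close>
  have empty: "\<mu> {} = 0"
  proof -
    have "\<mu> Y + \<mu> {} = \<mu> Y + 0"
      using add[of Y "{}"] YG by simp
    then show ?thesis
      using one by (subst (asm) ennreal_add_left_cancel) auto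
  qed
  have img: "\<mu> (?f b ` Y) = 1" for b
  proof -
    have "inj_on (?f b) Y"
      using f by (auto simp: inj_on_def)
    moreover have "\<exists>k\<in>K. f (x, b) = k \<otimes> x" if "x \<in> Y" for x
      using fE[of "(x, b)"] that by (auto simp: E_def set_mult_def)
    ultimately have "\<mu> (?f b ` Y) = \<mu> Y"
      by (intro invariant_measure_image[OF add inv empty K YG])
    then show ?thesis by (simp only: one)
  qed
  have sub: "?f b ` Y \<subseteq> Y" for b
    using fE by (force simp: E_def)
  have disj: "?f True ` Y \<inter> ?f False ` Y = {}"
    using f by (auto simp: inj_on_def)
  define U where "U = ?f True ` Y \<union> ?f False ` Y"
  have UY: "U \<subseteq> Y" using sub by (simp add: U_def)
  have "\<mu> U = \<mu> (?f True ` Y) + \<mu> (?f False ` Y)"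
    unfolding U_def using sub YG disj by (intro add) blast+
  then have U2: "\<mu> U = 2" using img by simp
  have "\<mu> (U \<union> (Y - U)) = \<mu> U + \<mu> (Y - U)"
    using UY YG by (intro add) auto
  moreover have "U \<union> (Y - U) = Y" using UY by blast
  ultimately have "(1::ennreal) = 2 + \<mu> (Y - U)" using one U2 by simp
  moreover have "(2::ennreal) \<le> 2 + \<mu> (Y - U)" by simp
  ultimately have "(2::ennreal) \<le> 1" by simp
  then show False by simp
qed

end

section \<open>Right invertible matrices and the unbounded generating number\<close>
lemma additive_map_finsum:
  assumes M: "abelian_group M" and N: "abelian_group N"
    and closed: "\<And>x. x \<in> carrier M \<Longrightarrow> h x \<in> carrier N"
    and add: "\<And>x y. x \<in> carrier M \<Longrightarrow> y \<in> carrier M \<Longrightarrow> h (x \<oplus>\<^bsub>M\<^esub> y) = h x \<oplus>\<^bsub>N\<^esub> h y"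
    and f: "\<And>i. i \<in> I \<Longrightarrow> f i \<in> carrier M"
  shows "h (finsum M f I) = finsum N (\<lambda>i. h (f i)) I"
proof -
  interpret M: abelian_group M by (rule M)
  interpret N: abelian_group N by (rule N)
  have "h \<zero>\<^bsub>M\<^esub> \<oplus>\<^bsub>N\<^esub> h \<zero>\<^bsub>M\<^esub> = h \<zero>\<^bsub>M\<^esub>"
    using add[of "\<zero>\<^bsub>M\<^esub>" "\<zero>\<^bsub>M\<^esub>"] by simp
  then have zero: "h \<zero>\<^bsub>M\<^esub> = \<zero>\<^bsub>N\<^esub>"
    using closed[of "\<zero>\<^bsub>M\<^esub>"] N.add.l_cancel_one by simp
  show ?thesis
    using f
  proof (induction I rule: infinite_finite_induct)
    case (insert i I)
    then have *: "f \<in> I \<rightarrow> carrier M" "f i \<in> carrier M" "(\<lambda>i. h (f i)) \<in> I \<rightarrow> carrier N"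
      using closed by auto
    have "h (finsum M f (insert i I)) = h (f i \<oplus>\<^bsub>M\<^esub> finsum M f I)"
      using insert * by simp
    also have "\<dots> = h (f i) \<oplus>\<^bsub>N\<^esub> finsum N (\<lambda>i. h (f i)) I"
      using insert * add by simp
    also have "\<dots> = finsum N (\<lambda>i. h (f i)) (insert i I)"
      using insert * closed by simp
    finally show ?case .
  qed (simp_all add: zero)
qed

lemma (in abelian_monoid) finsum_Sigma:
  assumes "finite I" "\<And>i. i \<in> I \<Longrightarrow> finite (J i)"
    and f: "\<And>i j. i \<in> I \<Longrightarrow> j \<in> J i \<Longrightarrow> f (i, j) \<in> carrier G"
  shows "finsum G f (Sigma I J) = (\<Oplus>i\<in>I. \<Oplus>j\<in>J i. f (i, j))"
  using assms
proof (induction I rule: finite_induct)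
  case (insert i I)
  have "Sigma (insert i I) J = Pair i ` J i \<union> Sigma I J" by auto
  then have "finsum G f (Sigma (insert i I) J) = finsum G f (Pair i ` J i \<union> Sigma I J)" by simp
  also have "\<dots> = finsum G f (Pair i ` J i) \<oplus> finsum G f (Sigma I J)"
    using insert by (intro finsum_Un_disjoint) auto
  also have "finsum G f (Pair i ` J i) = (\<Oplus>j\<in>J i. f (i, j))"
    using insert by (intro finsum_reindex) (auto simp: inj_on_def)
  also have "finsum G f (Sigma I J) = (\<Oplus>i\<in>I. \<Oplus>j\<in>J i. f (i, j))"
    using insert by auto
  also have "(\<Oplus>j\<in>J i. f (i, j)) \<oplus> (\<Oplus>i\<in>I. \<Oplus>j\<in>J i. f (i, j)) = (\<Oplus>i\<in>insert i I. \<Oplus>j\<in>J i. f (i, j))"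
    using insert by (intro finsum_insert[symmetric]) auto
  finally show ?case .
qed simp

text \<open>The vector \<open>k\<close> of the standard basis of \<open>S\<^sup>n\<close>, extended by \<open>undefined\<close> outside \<open>{..<n}\<close>
  like all elements of the free module.\<close>
definition unit_vector :: "('s, 'k) ring_scheme \<Rightarrow> nat \<Rightarrow> nat \<Rightarrow> nat \<Rightarrow> 's" where
  "unit_vector S n k = (\<lambda>i\<in>{..<n}. if i = k then \<one>\<^bsub>S\<^esub> else \<zero>\<^bsub>S\<^esub>)"

text \<open>There are a matrix \<open>P\<close> with rows indexed by \<open>J\<close> and columns indexed by \<open>I\<close> and a matrix \<open>Q\<close>
  of the transposed format with \<open>P Q = 1\<close>. The index sets are arbitrary, since matrices indexed by
  tuples arise below; they should be finite, as an infinite sum is \<open>\<zero>\<close> by convention.\<close>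
definition right_invertible_matrix :: "('s, 'k) ring_scheme \<Rightarrow> 'i set \<Rightarrow> 'j set \<Rightarrow> bool" where
  "right_invertible_matrix S I J \<longleftrightarrow> (\<exists>P Q.
     (\<forall>j\<in>J. \<forall>i\<in>I. P j i \<in> carrier S \<and> Q i j \<in> carrier S) \<and>
     (\<forall>j\<in>J. \<forall>j'\<in>J. (\<Oplus>\<^bsub>S\<^esub>i\<in>I. P j i \<otimes>\<^bsub>S\<^esub> Q i j') = (if j = j' then \<one>\<^bsub>S\<^esub> else \<zero>\<^bsub>S\<^esub>)))"

lemma right_module_homD:
  assumes "h \<in> right_module_hom S M N" and "x \<in> carrier M"
  shows "h x \<in> carrier N"
    and "y \<in> carrier M \<Longrightarrow> h (x \<oplus>\<^bsub>M\<^esub> y) = h x \<oplus>\<^bsub>N\<^esub> h y"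
    and "s \<in> carrier S \<Longrightarrow> h (s \<odot>\<^bsub>M\<^esub> x) = s \<odot>\<^bsub>N\<^esub> h x"
  using assms by (auto simp: right_module_hom_def hom_def)

lemma right_module_homI:
  assumes "\<And>x. x \<in> carrier M \<Longrightarrow> h x \<in> carrier N"
    and "\<And>x y. x \<in> carrier M \<Longrightarrow> y \<in> carrier M \<Longrightarrow> h (x \<oplus>\<^bsub>M\<^esub> y) = h x \<oplus>\<^bsub>N\<^esub> h y"
    and "\<And>x s. x \<in> carrier M \<Longrightarrow> s \<in> carrier S \<Longrightarrow> h (s \<odot>\<^bsub>M\<^esub> x) = s \<odot>\<^bsub>N\<^esub> h x"
  shows "h \<in> right_module_hom S M N"
  using assms by (auto simp: right_module_hom_def hom_def)

lemma right_module_epi_comp: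
  assumes f: "f \<in> right_module_epi S L M" and g: "g \<in> right_module_epi S M N"
  shows "g \<circ> f \<in> right_module_epi S L N"
proof -
  have f': "f \<in> right_module_hom S L M" and g': "g \<in> right_module_hom S M N"
    using f g by (auto simp: right_module_epi_def)
  have "g \<circ> f \<in> right_module_hom S L N"
    by (rule right_module_homI) (simp_all add: right_module_homD[OF f'] right_module_homD[OF g'])
  moreover have "(g \<circ> f) ` carrier L = carrier N"
    using f g by (simp only: right_module_epi_def image_comp[symmetric] mem_Collect_eq)
  ultimately show ?thesis by (simp add: right_module_epi_def)
qed

context ring
begin

abbreviation "Free \<equiv> free_right_module R"

lemma free_carrier: "carrier (Free n) = {..<n} \<rightarrow>\<^sub>E carrier R"
  by (simp add: free_right_module_def)

lemma free_nth_closed: "x \<in> carrier (Free n) \<Longrightarrow> i < n \<Longrightarrow> x i \<in> carrier R"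
  by (auto simp: free_right_module_def)

lemma free_eqI:
  assumes "x \<in> carrier (Free n)" "y \<in> carrier (Free n)" "\<And>i. i < n \<Longrightarrow> x i = y i"
  shows "x = y"
  using assms by (auto simp: free_carrier intro: PiE_ext)

lemma free_nth:
  assumes "i < n"
  shows "(x \<oplus>\<^bsub>Free n\<^esub> y) i = x i \<oplus> y i" and "(s \<odot>\<^bsub>Free n\<^esub> x) i = x i \<otimes> s"
    and "unit_vector R n k i = (if i = k then \<one> else \<zero>)"
  using assms by (simp_all add: free_right_module_def unit_vector_def)

lemma unit_vector_closed: "unit_vector R n k \<in> carrier (Free n)"
  by (simp add: free_right_module_def unit_vector_def)

lemma finsum_delta:
  assumes "finite I" "i \<in> I" "a \<in> carrier R"
  shows "(\<Oplus>j\<in>I. if i = j then a else \<zero>) = a"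
  using add.finprod_singleton[OF assms(2,1), of "\<lambda>_. a"] assms by simp

lemma free_finsum_nth:
  assumes "\<And>k. k \<in> I \<Longrightarrow> v k \<in> carrier (Free n)" and "i < n"
  shows "finsum (Free n) v I i = (\<Oplus>k\<in>I. v k i)"
proof -
  interpret F: right_module R "Free n" by (rule free_right_module)
  show ?thesis
    by (rule additive_map_finsum[where h = "\<lambda>x. x i", OF F.abelian_group_axioms abelian_group_axioms])
      (use assms in \<open>auto simp: free_nth free_nth_closed\<close>)
qed

lemma free_module_expansion:
  assumes x: "x \<in> carrier (Free n)"
  shows "x = finsum (Free n) (\<lambda>k. x k \<odot>\<^bsub>Free n\<^esub> unit_vector R n k) {..<n}"
proof -
  interpret F: right_module R "Free n" by (rule free_right_module)
  have cl: "x k \<odot>\<^bsub>Free n\<^esub> unit_vector R n k \<in> carrier (Free n)" if "k < n" for k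
    using free_nth_closed[OF x that] unit_vector_closed F.smult_closed by blast
  show ?thesis
  proof (rule free_eqI[OF x])
    show "finsum (Free n) (\<lambda>k. x k \<odot>\<^bsub>Free n\<^esub> unit_vector R n k) {..<n} \<in> carrier (Free n)"
      using cl by (intro F.finsum_closed) auto
    fix i assume i: "i < n"
    have "finsum (Free n) (\<lambda>k. x k \<odot>\<^bsub>Free n\<^esub> unit_vector R n k) {..<n} i
        = (\<Oplus>k\<in>{..<n}. (x k \<odot>\<^bsub>Free n\<^esub> unit_vector R n k) i)"
      using cl i by (intro free_finsum_nth) auto
    also have "\<dots> = (\<Oplus>k\<in>{..<n}. if i = k then x i else \<zero>)"
      by (rule finsum_cong') (use i free_nth_closed[OF x] in \<open>auto simp: free_nth\<close>)
    also have "\<dots> = x i"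
      using i free_nth_closed[OF x] by (intro finsum_delta) auto
    finally show "x i = finsum (Free n) (\<lambda>k. x k \<odot>\<^bsub>Free n\<^esub> unit_vector R n k) {..<n} i" ..
  qed
qed

lemma hom_from_free_module:
  assumes M: "right_module R M" and h: "h \<in> right_module_hom R (Free n) M"
    and x: "x \<in> carrier (Free n)"
  shows "h x = finsum M (\<lambda>k. x k \<odot>\<^bsub>M\<^esub> h (unit_vector R n k)) {..<n}"
proof -
  interpret F: right_module R "Free n" by (rule free_right_module)
  interpret M: right_module R M by (rule M)
  have cl: "x k \<odot>\<^bsub>Free n\<^esub> unit_vector R n k \<in> carrier (Free n)" if "k < n" for k
    using free_nth_closed[OF x that] unit_vector_closed F.smult_closed by blast
  have "h x = h (finsum (Free n) (\<lambda>k. x k \<odot>\<^bsub>Free n\<^esub> unit_vector R n k) {..<n})"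
    using free_module_expansion[OF x] by simp
  also have "\<dots> = finsum M (\<lambda>k. h (x k \<odot>\<^bsub>Free n\<^esub> unit_vector R n k)) {..<n}"
    by (rule additive_map_finsum[OF F.abelian_group_axioms M.abelian_group_axioms])
      (use cl right_module_homD[OF h] in auto)
  also have "\<dots> = finsum M (\<lambda>k. x k \<odot>\<^bsub>M\<^esub> h (unit_vector R n k)) {..<n}"
    by (rule M.finsum_cong')
      (use free_nth_closed[OF x] right_module_homD[OF h unit_vector_closed] M.smult_closed in auto)
  finally show ?thesis .
qed

text \<open>A free module is projective, so an epimorphism onto it splits: the matrix \<open>Q\<close> lists preimages of
  the standard basis vectors.\<close>
lemma epi_free_iff_right_invertible_matrix:
  "right_module_epi R (Free a) (Free b) \<noteq> {} \<longleftrightarrow> right_invertible_matrix R {..<a} {..<b}"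
proof
  assume "right_module_epi R (Free a) (Free b) \<noteq> {}"
  then obtain h where h: "h \<in> right_module_hom R (Free a) (Free b)"
    and surj: "h ` carrier (Free a) = carrier (Free b)"
    by (auto simp: right_module_epi_def)
  interpret B: right_module R "Free b" by (rule free_right_module)
  have "\<exists>q\<in>carrier (Free a). h q = unit_vector R b j" for j
    using surj unit_vector_closed[of b j] by (metis imageE)
  then obtain q where q: "\<And>j. q j \<in> carrier (Free a)" "\<And>j. h (q j) = unit_vector R b j"
    by metis
  have hu: "h (unit_vector R a i) \<in> carrier (Free b)" for i
    using right_module_homD(1)[OF h unit_vector_closed] .
  have "(\<Oplus>i\<in>{..<a}. h (unit_vector R a i) j \<otimes> q j' i) = (if j = j' then \<one> else \<zero>)"
    if j: "j < b" "j' < b" for j j'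
  proof -
    have "(\<Oplus>i\<in>{..<a}. h (unit_vector R a i) j \<otimes> q j' i)
        = (\<Oplus>i\<in>{..<a}. (q j' i \<odot>\<^bsub>Free b\<^esub> h (unit_vector R a i)) j)"
      by (rule finsum_cong')
        (use j free_nth_closed[OF hu] free_nth_closed[OF q(1)] in \<open>auto simp: free_nth\<close>)
    also have "\<dots> = finsum (Free b) (\<lambda>i. q j' i \<odot>\<^bsub>Free b\<^esub> h (unit_vector R a i)) {..<a} j"
      using j hu free_nth_closed[OF q(1)] B.smult_closed by (intro free_finsum_nth[symmetric]) auto
    also have "\<dots> = h (q j') j"
      using hom_from_free_module[OF B.right_module_axioms h q(1)] by simp
    also have "\<dots> = (if j = j' then \<one> else \<zero>)"
      using j by (simp add: q(2) free_nth)
    finally show ?thesis .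
  qed
  then show "right_invertible_matrix R {..<a} {..<b}"
    unfolding right_invertible_matrix_def
    by (intro exI[of _ "\<lambda>j i. h (unit_vector R a i) j"] exI[of _ "\<lambda>i j. q j i"])
      (use free_nth_closed[OF hu] free_nth_closed[OF q(1)] in auto)
next
  assume "right_invertible_matrix R {..<a} {..<b}"
  then obtain P Q where PQ': "\<forall>j\<in>{..<b}. \<forall>i\<in>{..<a}. P j i \<in> carrier R \<and> Q i j \<in> carrier R"
    and id': "\<forall>j\<in>{..<b}. \<forall>j'\<in>{..<b}. (\<Oplus>i\<in>{..<a}. P j i \<otimes> Q i j') = (if j = j' then \<one> else \<zero>)"
    unfolding right_invertible_matrix_def by blast
  have PQ: "P j i \<in> carrier R" "Q i j \<in> carrier R" if "i \<in> {..<a}" "j \<in> {..<b}" for i j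
    using PQ' that by simp_all
  have id: "(\<Oplus>i\<in>{..<a}. P j i \<otimes> Q i j') = (if j = j' then \<one> else \<zero>)"
    if "j \<in> {..<b}" "j' \<in> {..<b}" for j j'
    using id' that by simp
  let ?h = "\<lambda>x. \<lambda>j\<in>{..<b}. \<Oplus>i\<in>{..<a}. P j i \<otimes> x i"
  have hcl: "?h x \<in> carrier (Free b)" if "x \<in> carrier (Free a)" for x
    using PQ free_nth_closed[OF that] by (auto simp: free_carrier)
  interpret A: right_module R "Free a" by (rule free_right_module)
  interpret B: right_module R "Free b" by (rule free_right_module)
  have hom: "?h \<in> right_module_hom R (Free a) (Free b)"
  proof (rule right_module_homI)
    fix x assume x: "x \<in> carrier (Free a)"
    then show "?h x \<in> carrier (Free b)" by (rule hcl)
    show "?h (x \<oplus>\<^bsub>Free a\<^esub> y) = ?h x \<oplus>\<^bsub>Free b\<^esub> ?h y" if y: "y \<in> carrier (Free a)" for y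
    proof (rule free_eqI)
      fix j assume j: "j < b"
      have "(\<Oplus>i\<in>{..<a}. P j i \<otimes> (x \<oplus>\<^bsub>Free a\<^esub> y) i)
          = (\<Oplus>i\<in>{..<a}. P j i \<otimes> x i \<oplus> P j i \<otimes> y i)"
        by (rule finsum_cong')
          (use j PQ free_nth_closed[OF x] free_nth_closed[OF y] in \<open>auto simp: free_nth r_distr\<close>)
      also have "\<dots> = (\<Oplus>i\<in>{..<a}. P j i \<otimes> x i) \<oplus> (\<Oplus>i\<in>{..<a}. P j i \<otimes> y i)"
        by (rule finsum_addf) (use j PQ free_nth_closed[OF x] free_nth_closed[OF y] in auto)
      finally show "?h (x \<oplus>\<^bsub>Free a\<^esub> y) j = (?h x \<oplus>\<^bsub>Free b\<^esub> ?h y) j"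
        using j by (simp add: free_nth)
    qed (use x y hcl in auto)
    show "?h (s \<odot>\<^bsub>Free a\<^esub> x) = s \<odot>\<^bsub>Free b\<^esub> ?h x" if s: "s \<in> carrier R" for s
    proof (rule free_eqI)
      fix j assume j: "j < b"
      have "(\<Oplus>i\<in>{..<a}. P j i \<otimes> (s \<odot>\<^bsub>Free a\<^esub> x) i) = (\<Oplus>i\<in>{..<a}. (P j i \<otimes> x i) \<otimes> s)"
        by (rule finsum_cong')
          (use j s PQ free_nth_closed[OF x] in \<open>auto simp: free_nth m_assoc\<close>)
      also have "\<dots> = (\<Oplus>i\<in>{..<a}. P j i \<otimes> x i) \<otimes> s"
        by (rule finsum_ldistr[symmetric]) (use j s PQ free_nth_closed[OF x] in auto)
      finally show "?h (s \<odot>\<^bsub>Free a\<^esub> x) j = (s \<odot>\<^bsub>Free b\<^esub> ?h x) j"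
        using j by (simp add: free_nth)
    qed (use x s hcl A.smult_closed B.smult_closed in auto)
  qed
  have "carrier (Free b) \<subseteq> ?h ` carrier (Free a)"
  proof
    fix y assume y: "y \<in> carrier (Free b)"
    let ?q = "\<lambda>j. \<lambda>i\<in>{..<a}. Q i j"
    have q: "?q j \<in> carrier (Free a)" if "j < b" for j
      using PQ that by (auto simp: free_carrier)
    let ?x = "finsum (Free a) (\<lambda>j. y j \<odot>\<^bsub>Free a\<^esub> ?q j) {..<b}"
    have cl: "y j \<odot>\<^bsub>Free a\<^esub> ?q j \<in> carrier (Free a)" if "j < b" for j
      using q that free_nth_closed[OF y] A.smult_closed by auto
    have hq: "?h (?q j) = unit_vector R b j" if j: "j < b" for j
    proof (rule free_eqI[OF hcl[OF q[OF j]] unit_vector_closed])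
      fix j' assume j': "j' < b"
      have "(\<Oplus>i\<in>{..<a}. P j' i \<otimes> ?q j i) = (\<Oplus>i\<in>{..<a}. P j' i \<otimes> Q i j)"
        by (rule finsum_cong') (use j j' PQ in auto)
      then show "?h (?q j) j' = unit_vector R b j j'"
        using j j' id by (simp add: free_nth)
    qed
    have "?h ?x = finsum (Free b) (\<lambda>j. ?h (y j \<odot>\<^bsub>Free a\<^esub> ?q j)) {..<b}"
      by (intro additive_map_finsum[OF A.abelian_group_axioms B.abelian_group_axioms]
          right_module_homD(1,2)[OF hom] cl) simp_all
    also have "\<dots> = finsum (Free b) (\<lambda>j. y j \<odot>\<^bsub>Free b\<^esub> unit_vector R b j) {..<b}"
    proof (rule B.finsum_cong')
      fix j assume "j \<in> {..<b}"
      then have j: "j < b" by simp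
      show "?h (y j \<odot>\<^bsub>Free a\<^esub> ?q j) = y j \<odot>\<^bsub>Free b\<^esub> unit_vector R b j"
        using right_module_homD(3)[OF hom q[OF j] free_nth_closed[OF y j]] by (simp only: hq[OF j])
    qed (use free_nth_closed[OF y] unit_vector_closed B.smult_closed in auto)
    also have "\<dots> = y" by (rule free_module_expansion[OF y, symmetric])
    finally have "y = ?h ?x" ..
    moreover have "?x \<in> carrier (Free a)"
      using cl by (intro A.finsum_closed) auto
    ultimately show "y \<in> ?h ` carrier (Free a)" by (rule image_eqI)
  qed
  then have "?h ` carrier (Free a) = carrier (Free b)"
    using hcl by blast
  then show "right_module_epi R (Free a) (Free b) \<noteq> {}"
    using hom by (auto simp: right_module_epi_def)
qed

lemma right_invertible_matrix_trans:
  fixes a b c :: nat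
  assumes "right_invertible_matrix R {..<a} {..<b}" "right_invertible_matrix R {..<b} {..<c}"
  shows "right_invertible_matrix R {..<a} {..<c}"
proof -
  obtain f g where "f \<in> right_module_epi R (Free a) (Free b)" "g \<in> right_module_epi R (Free b) (Free c)"
    using assms unfolding epi_free_iff_right_invertible_matrix[symmetric] by fast
  from right_module_epi_comp[OF this] show ?thesis
    unfolding epi_free_iff_right_invertible_matrix[symmetric] by fast
qed

text \<open>Add a diagonal entry \<open>\<one>\<close> to both matrices.\<close>
lemma right_invertible_matrix_Suc:
  fixes a b :: nat
  assumes "right_invertible_matrix R {..<a} {..<b}"
  shows "right_invertible_matrix R {..<Suc a} {..<Suc b}"
proof -
  obtain P Q where PQ': "\<forall>j\<in>{..<b}. \<forall>i\<in>{..<a}. P j i \<in> carrier R \<and> Q i j \<in> carrier R"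
    and id': "\<forall>j\<in>{..<b}. \<forall>j'\<in>{..<b}. (\<Oplus>i\<in>{..<a}. P j i \<otimes> Q i j') = (if j = j' then \<one> else \<zero>)"
    using assms unfolding right_invertible_matrix_def by blast
  have PQ: "P j i \<in> carrier R" "Q i j \<in> carrier R" if "i \<in> {..<a}" "j \<in> {..<b}" for i j
    using PQ' that by simp_all
  have id: "(\<Oplus>i\<in>{..<a}. P j i \<otimes> Q i j') = (if j = j' then \<one> else \<zero>)"
    if "j \<in> {..<b}" "j' \<in> {..<b}" for j j'
    using id' that by simp
  define P' where "P' j i = (if i < a \<and> j < b then P j i else if i = a \<and> j = b then \<one> else \<zero>)" for j i
  define Q' where "Q' i j = (if i < a \<and> j < b then Q i j else if i = a \<and> j = b then \<one> else \<zero>)" for i j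
  have cl: "P' j i \<in> carrier R" "Q' i j \<in> carrier R" for i j
    using PQ by (auto simp: P'_def Q'_def)
  have "(\<Oplus>i\<in>{..<Suc a}. P' j i \<otimes> Q' i j') = (if j = j' then \<one> else \<zero>)"
    if j: "j < Suc b" "j' < Suc b" for j j'
  proof -
    have "(\<Oplus>i\<in>{..<Suc a}. P' j i \<otimes> Q' i j') = P' j a \<otimes> Q' a j' \<oplus> (\<Oplus>i\<in>{..<a}. P' j i \<otimes> Q' i j')"
      using cl by (simp add: lessThan_Suc)
    also have "(\<Oplus>i\<in>{..<a}. P' j i \<otimes> Q' i j') = (if j < b \<and> j' < b \<and> j = j' then \<one> else \<zero>)"
    proof (cases "j < b \<and> j' < b")
      case True
      then have "(\<Oplus>i\<in>{..<a}. P' j i \<otimes> Q' i j') = (\<Oplus>i\<in>{..<a}. P j i \<otimes> Q i j')"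
        by (intro finsum_cong') (use PQ in \<open>auto simp: P'_def Q'_def\<close>)
      with True id show ?thesis by simp
    next
      case False
      then have "(\<Oplus>i\<in>{..<a}. P' j i \<otimes> Q' i j') = (\<Oplus>i\<in>{..<a}. \<zero>)"
        by (intro finsum_cong') (use PQ in \<open>auto simp: P'_def Q'_def\<close>)
      with False show ?thesis by auto
    qed
    also have "P' j a \<otimes> Q' a j' = (if j = b \<and> j' = b then \<one> else \<zero>)"
      by (simp add: P'_def Q'_def)
    finally show ?thesis using j by auto
  qed
  then show ?thesis
    unfolding right_invertible_matrix_def using cl
    by (intro exI[of _ P'] exI[of _ Q']) auto
qed

lemma right_invertible_matrix_subset:
  assumes "right_invertible_matrix R I J" "J' \<subseteq> J"
  shows "right_invertible_matrix R I J'"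
proof -
  obtain P Q where "\<forall>j\<in>J. \<forall>i\<in>I. P j i \<in> carrier R \<and> Q i j \<in> carrier R"
    and "\<forall>j\<in>J. \<forall>j'\<in>J. (\<Oplus>i\<in>I. P j i \<otimes> Q i j') = (if j = j' then \<one> else \<zero>)"
    using assms(1) by (auto simp: right_invertible_matrix_def)
  then show ?thesis
    unfolding right_invertible_matrix_def using assms(2)
    by (intro exI[of _ P] exI[of _ Q]) (simp add: subset_iff)
qed

lemma right_invertible_matrix_reindex:
  assumes inv: "right_invertible_matrix R I J" and f: "bij_betw f I' I" and g: "bij_betw g J' J"
  shows "right_invertible_matrix R I' J'"
proof -
  obtain P Q where PQ': "\<forall>j\<in>J. \<forall>i\<in>I. P j i \<in> carrier R \<and> Q i j \<in> carrier R"
    and id': "\<forall>j\<in>J. \<forall>j'\<in>J. (\<Oplus>i\<in>I. P j i \<otimes> Q i j') = (if j = j' then \<one> else \<zero>)"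
    using inv unfolding right_invertible_matrix_def by blast
  have PQ: "P j i \<in> carrier R" "Q i j \<in> carrier R" if "i \<in> I" "j \<in> J" for i j
    using PQ' that by simp_all
  have id: "(\<Oplus>i\<in>I. P j i \<otimes> Q i j') = (if j = j' then \<one> else \<zero>)"
    if "j \<in> J" "j' \<in> J" for j j'
    using id' that by simp
  have fI: "f i \<in> I" if "i \<in> I'" for i using f that by (auto simp: bij_betw_def)
  have gJ: "g j \<in> J" if "j \<in> J'" for j using g that by (auto simp: bij_betw_def)
  have "(\<Oplus>i\<in>I'. P (g j) (f i) \<otimes> Q (f i) (g j')) = (if j = j' then \<one> else \<zero>)"
    if j: "j \<in> J'" "j' \<in> J'" for j j'
  proof -
    have "(\<Oplus>i\<in>I'. P (g j) (f i) \<otimes> Q (f i) (g j')) = (\<Oplus>i\<in>f ` I'. P (g j) i \<otimes> Q i (g j'))"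
      by (rule finsum_reindex[symmetric]) (use f PQ gJ fI j in \<open>auto simp: bij_betw_def\<close>)
    also have "\<dots> = (if g j = g j' then \<one> else \<zero>)"
      using f id gJ j by (simp add: bij_betw_def)
    also have "g j = g j' \<longleftrightarrow> j = j'"
      using g j by (auto simp: bij_betw_def inj_on_def)
    finally show ?thesis .
  qed
  then show ?thesis
    unfolding right_invertible_matrix_def using PQ fI gJ
    by (intro exI[of _ "\<lambda>j i. P (g j) (f i)"] exI[of _ "\<lambda>i j. Q (f i) (g j)"]) auto
qed

lemma UGN_iff: "UGN R \<longleftrightarrow> (\<forall>n>0. \<not> right_invertible_matrix R {..<n} {..<Suc n})"
  unfolding UGN_def epi_free_iff_right_invertible_matrix[symmetric] by simp

text \<open>Adding identity blocks to an epimorphism \<open>R\<^sup>n \<rightarrow> R\<^sup>n\<^sup>+\<^sup>1\<close> and composing gives epimorphisms from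
  \<open>R\<^sup>n\<close> onto free modules of every larger rank.\<close>
lemma not_UGN_imp_right_invertible_matrix:
  assumes "\<not> UGN R"
  shows "\<exists>n>0. \<forall>m\<ge>n. right_invertible_matrix R {..<n::nat} {..<m}"
proof -
  obtain n where n: "n > 0" and step: "right_invertible_matrix R {..<n} {..<Suc n}"
    using assms by (auto simp: UGN_iff)
  have up: "right_invertible_matrix R {..<n + k} {..<Suc (n + k)}" for k
    by (induction k) (use step right_invertible_matrix_Suc in auto)
  have all: "right_invertible_matrix R {..<n} {..<Suc (n + k)}" for k
  proof (induction k)
    case (Suc k)
    then show ?case
      using right_invertible_matrix_trans[of n "Suc (n + k)" "Suc (n + Suc k)"] up[of "Suc k"] by simp
  qed (use step in simp)
  have "right_invertible_matrix R {..<n} {..<m}" if "n \<le> m" for m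
    by (rule right_invertible_matrix_subset[OF all[of "m - n"]]) (use that in auto)
  with n show ?thesis by blast
qed

lemma UGN_card_le:
  assumes UGN: "UGN R" and PQ: "right_invertible_matrix R I J" and fin: "finite I" "finite J"
  shows "card J \<le> card I"
proof (rule ccontr)
  assume "\<not> card J \<le> card I"
  then have sub: "{..<Suc (card I)} \<subseteq> {..<card J}" by auto
  obtain f g where "bij_betw f {..<card I} I" "bij_betw g {..<card J} J"
    using fin ex_bij_betw_nat_finite by (metis atLeast0LessThan)
  then have "right_invertible_matrix R {..<card I} {..<card J}"
    by (rule right_invertible_matrix_reindex[OF PQ])
  then have *: "right_invertible_matrix R {..<card I} {..<Suc (card I)}"
    using sub by (rule right_invertible_matrix_subset)
  \<comment> \<open>One step further, so that the case of an empty \<open>I\<close> is covered as well.\<close>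
  then have "right_invertible_matrix R {..<Suc (card I)} {..<Suc (Suc (card I))}"
    by (rule right_invertible_matrix_Suc)
  with UGN show False by (auto simp: UGN_iff)
qed

section \<open>Matrices over a subring\<close>
lemma finsum_subring:
  assumes H: "subring H R" and f: "\<And>i. i \<in> I \<Longrightarrow> f i \<in> H"
  shows "finsum (R\<lparr>carrier := H\<rparr>) f I = finsum R f I"
proof -
  interpret H: ring "R\<lparr>carrier := H\<rparr>" by (rule subring_is_ring[OF H])
  show ?thesis
    by (rule additive_map_finsum[where h = "\<lambda>x. x", OF H.abelian_group_axioms abelian_group_axioms])
      (use f subringE(1)[OF H] in auto)
qed

lemma right_invertible_matrix_of_subring:
  assumes H: "subring H R" and "right_invertible_matrix (R\<lparr>carrier := H\<rparr>) I J"
  shows "right_invertible_matrix R I J"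
proof -
  obtain P Q where PQ: "\<forall>j\<in>J. \<forall>i\<in>I. P j i \<in> H \<and> Q i j \<in> H"
    and id: "\<forall>j\<in>J. \<forall>j'\<in>J.
      finsum (R\<lparr>carrier := H\<rparr>) (\<lambda>i. P j i \<otimes> Q i j') I = (if j = j' then \<one> else \<zero>)"
    using assms(2) unfolding right_invertible_matrix_def by auto
  have "finsum (R\<lparr>carrier := H\<rparr>) (\<lambda>i. P j i \<otimes> Q i j') I = (\<Oplus>i\<in>I. P j i \<otimes> Q i j')"
    if "j \<in> J" "j' \<in> J" for j j'
    by (rule finsum_subring[OF H]) (use PQ that subringE(6)[OF H] in auto)
  then show ?thesis
    unfolding right_invertible_matrix_def using PQ id subringE(1)[OF H]
    by (intro exI[of _ P] exI[of _ Q]) auto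
qed

text \<open>Let \<open>u b\<close> (\<open>b \<in> B\<close>) be a family in the right \<open>H\<close>-module \<open>R\<close> with dual \<open>H\<close>-linear maps
  \<open>c b\<close> from \<open>R\<close> to \<open>H\<close>, called coordinates, and suppose that \<open>Q\<close> maps the span of \<open>E\<close> (in each of the summands indexed by
  \<open>J\<close>) into the span of \<open>E'\<close>. Applying \<open>Q\<close>, then \<open>P\<close>, then the coordinates of \<open>E\<close> is the identity on
  the span of \<open>E\<close>, so the matrices over \<open>H\<close> of these maps are again right invertible. It does not
  matter that \<open>P\<close> need not map the span of \<open>E'\<close> into that of \<open>E\<close>.\<close>
lemma right_invertible_matrix_restrict_scalars:
  assumes H: "subring H R" and fin: "finite I" "finite E'" and sub: "E \<subseteq> B" "E' \<subseteq> B"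
    and PQ: "\<And>i j. i \<in> I \<Longrightarrow> j \<in> J \<Longrightarrow> P j i \<in> carrier R"
      "\<And>i j. i \<in> I \<Longrightarrow> j \<in> J \<Longrightarrow> Q i j \<in> carrier R"
    and id: "\<And>j j'. j \<in> J \<Longrightarrow> j' \<in> J \<Longrightarrow>
      (\<Oplus>i\<in>I. P j i \<otimes> Q i j') = (if j = j' then \<one> else \<zero>)"
    and u: "\<And>b. b \<in> B \<Longrightarrow> u b \<in> carrier R"
    and c: "\<And>b x. b \<in> B \<Longrightarrow> x \<in> carrier R \<Longrightarrow> c b x \<in> H"
    and c_add: "\<And>b x y. b \<in> B \<Longrightarrow> x \<in> carrier R \<Longrightarrow> y \<in> carrier R \<Longrightarrow> c b (x \<oplus> y) = c b x \<oplus> c b y"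
    and c_mult: "\<And>b x a. b \<in> B \<Longrightarrow> x \<in> carrier R \<Longrightarrow> a \<in> H \<Longrightarrow> c b (x \<otimes> a) = c b x \<otimes> a"
    and dual: "\<And>b b'. b \<in> B \<Longrightarrow> b' \<in> B \<Longrightarrow> c b (u b') = (if b = b' then \<one> else \<zero>)"
    and expand: "\<And>i j b. i \<in> I \<Longrightarrow> j \<in> J \<Longrightarrow> b \<in> E \<Longrightarrow>
      Q i j \<otimes> u b = (\<Oplus>e\<in>E'. u e \<otimes> c e (Q i j \<otimes> u b))"
  shows "right_invertible_matrix (R\<lparr>carrier := H\<rparr>) (I \<times> E') (J \<times> E)"
proof -
  have HR: "a \<in> carrier R" if "a \<in> H" for a
    using subringE(1)[OF H] that by blast
  define P' where "P' = (\<lambda>(j, b) (i, e). c b (P j i \<otimes> u e))"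
  define Q' where "Q' = (\<lambda>(i, e) (j, b). c e (Q i j \<otimes> u b))"
  have uE: "u b \<in> carrier R" if "b \<in> E" for b using u sub that by blast
  have uE': "u e \<in> carrier R" if "e \<in> E'" for e using u sub that by blast
  have P'H: "P' jb ie \<in> H" if "jb \<in> J \<times> E" "ie \<in> I \<times> E'" for jb ie
    using that PQ uE' sub by (auto simp: P'_def intro!: c)
  have Q'H: "Q' ie jb \<in> H" if "jb \<in> J \<times> E" "ie \<in> I \<times> E'" for jb ie
    using that PQ uE sub by (auto simp: Q'_def intro!: c)
  have "finsum (R\<lparr>carrier := H\<rparr>) (\<lambda>ie. P' jb ie \<otimes> Q' ie jb') (I \<times> E') = (if jb = jb' then \<one> else \<zero>)"
    if jb: "jb \<in> J \<times> E" "jb' \<in> J \<times> E" for jb jb'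
  proof -
    obtain j b j' b' where eqs: "jb = (j, b)" "jb' = (j', b')" by fastforce
    with jb have j: "j \<in> J" "j' \<in> J" and b: "b \<in> E" "b' \<in> E" by auto
    have bB: "b \<in> B" "b' \<in> B" using b sub by auto
    define w where "w i = Q i j' \<otimes> u b'" for i
    have w: "w i \<in> carrier R" if "i \<in> I" for i
      using that PQ j uE b by (simp add: w_def)
    have ce: "c e (w i) \<in> carrier R" if "i \<in> I" "e \<in> E'" for i e
      using that w c sub HR by blast
    define t where "t i e = P j i \<otimes> (u e \<otimes> c e (w i))" for i e
    have t: "t i e \<in> carrier R" if "i \<in> I" "e \<in> E'" for i e
      using that PQ j uE' ce by (simp add: t_def)
    have "finsum (R\<lparr>carrier := H\<rparr>) (\<lambda>ie. P' jb ie \<otimes> Q' ie jb') (I \<times> E')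
        = (\<Oplus>ie\<in>I \<times> E'. P' jb ie \<otimes> Q' ie jb')"
      by (rule finsum_subring[OF H]) (use P'H Q'H jb subringE(6)[OF H] in blast)
    also have "\<dots> = (\<Oplus>i\<in>I. \<Oplus>e\<in>E'. P' jb (i, e) \<otimes> Q' (i, e) jb')"
      using fin jb P'H Q'H HR by (intro finsum_Sigma) blast+
    also have "\<dots> = (\<Oplus>i\<in>I. \<Oplus>e\<in>E'. c b (t i e))"
    proof (intro finsum_cong' refl)
      fix i e assume ie: "i \<in> I" "e \<in> E'"
      have "t i e = (P j i \<otimes> u e) \<otimes> c e (w i)"
        using ie PQ j uE' ce by (simp add: t_def m_assoc)
      moreover have "c e (w i) \<in> H" using ie w c sub by blast
      ultimately have "c b (t i e) = c b (P j i \<otimes> u e) \<otimes> c e (w i)"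
        using ie PQ j uE' bB by (simp add: c_mult)
      then show "P' jb (i, e) \<otimes> Q' (i, e) jb' = c b (t i e)"
        by (simp add: P'_def Q'_def eqs w_def)
    qed (use t c bB HR in auto)
    also have "\<dots> = (\<Oplus>i\<in>I. c b (\<Oplus>e\<in>E'. t i e))"
      by (intro finsum_cong' refl additive_map_finsum[symmetric] abelian_group_axioms)
        (use t c c_add bB HR in auto)
    also have "\<dots> = (\<Oplus>i\<in>I. c b (P j i \<otimes> w i))"
    proof (intro finsum_cong' refl)
      fix i assume i: "i \<in> I"
      have "(\<Oplus>e\<in>E'. t i e) = P j i \<otimes> (\<Oplus>e\<in>E'. u e \<otimes> c e (w i))"
        unfolding t_def using i fin PQ j uE' ce by (intro finsum_rdistr[symmetric]) auto
      also have "(\<Oplus>e\<in>E'. u e \<otimes> c e (w i)) = w i"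
        using expand[OF i j(2) b(2)] by (simp add: w_def)
      finally show "c b (\<Oplus>e\<in>E'. t i e) = c b (P j i \<otimes> w i)" by simp
    qed (use PQ j w c bB HR in auto)
    also have "\<dots> = c b (\<Oplus>i\<in>I. P j i \<otimes> w i)"
      by (intro additive_map_finsum[symmetric] abelian_group_axioms)
        (use PQ j w c c_add bB HR in auto)
    also have "(\<Oplus>i\<in>I. P j i \<otimes> w i) = (\<Oplus>i\<in>I. P j i \<otimes> Q i j' \<otimes> u b')"
      by (intro finsum_cong') (use PQ j uE b in \<open>auto simp: w_def m_assoc\<close>)
    also have "\<dots> = (\<Oplus>i\<in>I. P j i \<otimes> Q i j') \<otimes> u b'"
      by (intro finsum_ldistr[symmetric]) (use fin PQ j uE b in auto)
    also have "\<dots> = (if j = j' then u b' else u b' \<otimes> \<zero>)"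
      using id j uE b by simp
    also have "c b \<dots> = (if jb = jb' then \<one> else \<zero>)"
      using dual[OF bB] dual[OF bB(2,2)] c_mult[OF bB(1) u[OF bB(2)] subringE(2)[OF H]] HR[OF c[OF bB(1) u[OF bB(2)]]]
      by (simp add: eqs)
    finally show ?thesis .
  qed
  then show ?thesis
    unfolding right_invertible_matrix_def using P'H Q'H
    by (intro exI[of _ P'] exI[of _ Q']) auto
qed

end

section \<open>Homogeneous parts and bases of the components\<close>

context graded_ring
begin

text \<open>The homogeneous part of \<open>x\<close> of degree \<open>g\<close>; for \<open>x\<close> in \<open>R\<close> it is \<open>undefined\<close> when \<open>g\<close> lies
  outside of the group.\<close>
definition homogeneous_part :: "'a \<Rightarrow> 'g \<Rightarrow> 'a" where
  "homogeneous_part x = (THE f. f \<in> (\<Pi>\<^sub>E g\<in>carrier G. A g) \<and>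
     finite {g \<in> carrier G. f g \<noteq> \<zero>\<^bsub>R\<^esub>} \<and> x = finsum R f {g \<in> carrier G. f g \<noteq> \<zero>\<^bsub>R\<^esub>})"

text \<open>The finite set of degrees in which \<open>x\<close> has a nonzero homogeneous part.\<close>
definition homogeneous_support :: "'a \<Rightarrow> 'g set" where
  "homogeneous_support x = {g \<in> carrier G. homogeneous_part x g \<noteq> \<zero>\<^bsub>R\<^esub>}"

lemma homogeneous_part:
  assumes "x \<in> carrier R"
  shows "g \<in> carrier G \<Longrightarrow> homogeneous_part x g \<in> A g"
    and "finite (homogeneous_support x)"
    and "x = finsum R (homogeneous_part x) (homogeneous_support x)"
  using theI'[OF direct_sum[OF assms], folded homogeneous_part_def]
  by (auto simp: homogeneous_support_def)

lemma homogeneous_part_in_carrier: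
  "x \<in> carrier R \<Longrightarrow> g \<in> carrier G \<Longrightarrow> homogeneous_part x g \<in> carrier R"
  using homogeneous_part(1) component_sub by blast

lemma sum_homogeneous_parts:
  assumes x: "x \<in> carrier R" and T: "finite T" "T \<subseteq> carrier G" "homogeneous_support x \<subseteq> T"
  shows "x = finsum R (homogeneous_part x) T"
proof -
  have "finsum R (homogeneous_part x) (homogeneous_support x) = finsum R (homogeneous_part x) T"
    using T homogeneous_part_in_carrier[OF x]
    by (intro R.add.finprod_mono_neutral_cong_left) (auto simp: homogeneous_support_def subset_iff)
  with homogeneous_part(3)[OF x] show ?thesis by simp
qed

lemma homogeneous_part_eqI:
  assumes T: "finite T" "T \<subseteq> carrier G" and v: "\<And>g. g \<in> T \<Longrightarrow> v g \<in> A g"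
    and x: "x = finsum R v T" and h: "h \<in> carrier G"
  shows "homogeneous_part x h = (if h \<in> T then v h else \<zero>\<^bsub>R\<^esub>)"
proof -
  have vR: "v g \<in> carrier R" if "g \<in> T" for g
    using v T(2) component_sub that by blast
  have xR: "x \<in> carrier R"
    unfolding x using vR by (intro R.finsum_closed) auto
  let ?T = "insert h (T \<union> homogeneous_support x)"
  let ?v = "\<lambda>g. if g \<in> T then v g else \<zero>\<^bsub>R\<^esub>"
  have T': "finite ?T" "?T \<subseteq> carrier G"
    using T h homogeneous_part(2)[OF xR] by (auto simp: homogeneous_support_def)
  have "finsum R v T = finsum R ?v ?T"
    using T' vR by (intro R.add.finprod_mono_neutral_cong_left) auto
  moreover have "x = finsum R (homogeneous_part x) ?T"
    by (rule sum_homogeneous_parts[OF xR T']) blast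
  ultimately have eq: "finsum R (homogeneous_part x) ?T = finsum R ?v ?T"
    using x by simp
  show ?thesis
    by (rule decomposition_unique[OF T' _ _ eq])
      (use T' v component_zero homogeneous_part(1)[OF xR] in auto)
qed

lemma homogeneous_part_of_component:
  assumes "g \<in> carrier G" "x \<in> A g" "h \<in> carrier G"
  shows "homogeneous_part x h = (if h = g then x else \<zero>\<^bsub>R\<^esub>)"
  using homogeneous_part_eqI[of "{g}" "\<lambda>_. x" x h] assms component_sub[OF assms(1,2)] by simp

lemma homogeneous_part_add:
  assumes x: "x \<in> carrier R" and y: "y \<in> carrier R" and g: "g \<in> carrier G"
  shows "homogeneous_part (x \<oplus>\<^bsub>R\<^esub> y) g = homogeneous_part x g \<oplus>\<^bsub>R\<^esub> homogeneous_part y g"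
proof -
  let ?T = "insert g (homogeneous_support x \<union> homogeneous_support y)"
  let ?v = "\<lambda>g. homogeneous_part x g \<oplus>\<^bsub>R\<^esub> homogeneous_part y g"
  have T: "finite ?T" "?T \<subseteq> carrier G"
    using g homogeneous_part(2)[OF x] homogeneous_part(2)[OF y] by (auto simp: homogeneous_support_def)
  have "x \<oplus>\<^bsub>R\<^esub> y = finsum R (homogeneous_part x) ?T \<oplus>\<^bsub>R\<^esub> finsum R (homogeneous_part y) ?T"
    by (intro arg_cong2[where f = "add R"] sum_homogeneous_parts x y T) auto
  also have "\<dots> = finsum R ?v ?T"
    using T homogeneous_part_in_carrier x y by (intro R.finsum_addf[symmetric]) blast+
  finally have eq: "x \<oplus>\<^bsub>R\<^esub> y = finsum R ?v ?T" .
  have "?v h \<in> A h" if "h \<in> ?T" for h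
    using that T homogeneous_part(1)[OF x] homogeneous_part(1)[OF y]
      additive_subgroup.a_closed[OF component_additive_subgroup] by blast
  from homogeneous_part_eqI[OF T this eq g] show ?thesis by simp
qed

lemma homogeneous_part_mult_base:
  assumes x: "x \<in> carrier R" and a: "a \<in> A \<one>\<^bsub>G\<^esub>" and g: "g \<in> carrier G"
  shows "homogeneous_part (x \<otimes>\<^bsub>R\<^esub> a) g = homogeneous_part x g \<otimes>\<^bsub>R\<^esub> a"
proof -
  let ?T = "insert g (homogeneous_support x)"
  let ?v = "\<lambda>g. homogeneous_part x g \<otimes>\<^bsub>R\<^esub> a"
  have aR: "a \<in> carrier R" using a component_sub by blast
  have T: "finite ?T" "?T \<subseteq> carrier G"
    using g homogeneous_part(2)[OF x] by (auto simp: homogeneous_support_def)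
  have "x \<otimes>\<^bsub>R\<^esub> a = finsum R (homogeneous_part x) ?T \<otimes>\<^bsub>R\<^esub> a"
    by (intro arg_cong[where f = "\<lambda>z. z \<otimes>\<^bsub>R\<^esub> a"] sum_homogeneous_parts x T) auto
  also have "\<dots> = finsum R ?v ?T"
    using T homogeneous_part_in_carrier x aR by (intro R.finsum_ldistr) blast+
  finally have eq: "x \<otimes>\<^bsub>R\<^esub> a = finsum R ?v ?T" .
  have "?v h \<in> A h" if "h \<in> ?T" for h
  proof -
    have h: "h \<in> carrier G" using that T by blast
    show ?thesis
      using component_mult[OF h G.one_closed homogeneous_part(1)[OF x h] a] h by simp
  qed
  from homogeneous_part_eqI[OF T this eq g] show ?thesis by simp
qed

lemma homogeneous_support_mult_component:
  assumes x: "x \<in> carrier R" and g: "g \<in> carrier G" and a: "a \<in> A g"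
  shows "homogeneous_support (x \<otimes>\<^bsub>R\<^esub> a) \<subseteq> homogeneous_support x <#>\<^bsub>G\<^esub> {g}"
proof -
  let ?S = "homogeneous_support x"
  have aR: "a \<in> carrier R" using a g component_sub by blast
  have S: "finite ?S" "?S \<subseteq> carrier G"
    using homogeneous_part(2)[OF x] by (auto simp: homogeneous_support_def)
  have SG: "k \<in> carrier G" if "k \<in> ?S" for k using S that by blast
  let ?T = "(\<lambda>k. k \<otimes>\<^bsub>G\<^esub> g) ` ?S"
  let ?v = "\<lambda>h. homogeneous_part x (h \<otimes>\<^bsub>G\<^esub> inv\<^bsub>G\<^esub> g) \<otimes>\<^bsub>R\<^esub> a"
  have T: "finite ?T" "?T \<subseteq> carrier G"
    using S g by auto
  have cancel: "k \<otimes>\<^bsub>G\<^esub> g \<otimes>\<^bsub>G\<^esub> inv\<^bsub>G\<^esub> g = k" if "k \<in> ?S" for k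
    using SG[OF that] g by (simp add: G.m_assoc)
  have vA: "?v h \<in> A h" if "h \<in> ?T" for h
  proof -
    obtain k where k: "k \<in> ?S" "h = k \<otimes>\<^bsub>G\<^esub> g" using \<open>h \<in> ?T\<close> by blast
    show ?thesis
      using component_mult[OF SG[OF k(1)] g homogeneous_part(1)[OF x SG[OF k(1)]] a]
      by (simp add: k(2) cancel[OF k(1)])
  qed
  have vR: "?v h \<in> carrier R" if "h \<in> ?T" for h
    using vA[OF that] T that component_sub by blast
  have inj: "inj_on (\<lambda>k. k \<otimes>\<^bsub>G\<^esub> g) ?S"
    using SG g by (auto simp: inj_on_def)
  have "x \<otimes>\<^bsub>R\<^esub> a = finsum R (homogeneous_part x) ?S \<otimes>\<^bsub>R\<^esub> a"
    by (rule arg_cong[where f = "\<lambda>z. z \<otimes>\<^bsub>R\<^esub> a", OF homogeneous_part(3)[OF x]])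
  also have "\<dots> = finsum R (\<lambda>k. homogeneous_part x k \<otimes>\<^bsub>R\<^esub> a) ?S"
    using S homogeneous_part_in_carrier x aR by (intro R.finsum_ldistr) blast+
  also have "\<dots> = finsum R (\<lambda>k. ?v (k \<otimes>\<^bsub>G\<^esub> g)) ?S"
    by (rule R.finsum_cong') (use cancel vR in auto)
  also have "\<dots> = finsum R ?v ?T"
    by (rule R.finsum_reindex[symmetric, OF _ inj]) (use vR in blast)
  finally have eq: "x \<otimes>\<^bsub>R\<^esub> a = finsum R ?v ?T" .
  have "h \<in> ?T" if "h \<in> homogeneous_support (x \<otimes>\<^bsub>R\<^esub> a)" for h
    using that homogeneous_part_eqI[OF T vA eq, of h]
    by (auto simp: homogeneous_support_def split: if_splits)
  then show ?thesis
    by (auto simp: set_mult_def)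
qed

text \<open>The elements \<open>u 0, \<dots>, u (d - 1)\<close> form a basis of the component at \<open>g\<close> as a right module over the
  base ring, and \<open>c s x\<close> is the coefficient of \<open>x\<close> at \<open>u s\<close>.\<close>
definition component_basis :: "'g \<Rightarrow> nat \<Rightarrow> (nat \<Rightarrow> 'a) \<Rightarrow> (nat \<Rightarrow> 'a \<Rightarrow> 'a) \<Rightarrow> bool" where
  "component_basis g d u c \<longleftrightarrow>
     (\<forall>s<d. u s \<in> A g) \<and> (\<forall>s<d. \<forall>x\<in>A g. c s x \<in> A \<one>\<^bsub>G\<^esub>) \<and>
     (\<forall>s<d. \<forall>x\<in>A g. \<forall>y\<in>A g. c s (x \<oplus>\<^bsub>R\<^esub> y) = c s x \<oplus>\<^bsub>R\<^esub> c s y) \<and>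
     (\<forall>s<d. \<forall>x\<in>A g. \<forall>a\<in>A \<one>\<^bsub>G\<^esub>. c s (x \<otimes>\<^bsub>R\<^esub> a) = c s x \<otimes>\<^bsub>R\<^esub> a) \<and>
     (\<forall>s<d. \<forall>t<d. c s (u t) = (if s = t then \<one>\<^bsub>R\<^esub> else \<zero>\<^bsub>R\<^esub>)) \<and>
     (\<forall>x\<in>A g. x = (\<Oplus>\<^bsub>R\<^esub>s\<in>{..<d}. u s \<otimes>\<^bsub>R\<^esub> c s x))"

lemma component_basis_exists:
  assumes g: "g \<in> carrier G"
    and phi: "\<phi> \<in> right_module_iso (base_ring G R A) (component_module R A g)
      (free_right_module (base_ring G R A) d)"
  shows "\<exists>u c. component_basis g d u c"
proof -
  let ?S = "base_ring G R A" and ?M = "component_module R A g"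
  interpret S: ring ?S by (rule ring_base_ring)
  interpret M: right_module ?S ?M by (rule component_right_module[OF g])
  interpret F: right_module ?S "S.Free d" by (rule S.free_right_module)
  have [simp]: "carrier ?M = A g" "carrier ?S = A \<one>\<^bsub>G\<^esub>" "\<And>x y. x \<oplus>\<^bsub>?M\<^esub> y = x \<oplus>\<^bsub>R\<^esub> y"
    "\<And>s x. s \<odot>\<^bsub>?M\<^esub> x = x \<otimes>\<^bsub>R\<^esub> s" "\<And>x y. x \<oplus>\<^bsub>?S\<^esub> y = x \<oplus>\<^bsub>R\<^esub> y"
    "\<And>x y. x \<otimes>\<^bsub>?S\<^esub> y = x \<otimes>\<^bsub>R\<^esub> y" "\<one>\<^bsub>?S\<^esub> = \<one>\<^bsub>R\<^esub>" "\<zero>\<^bsub>?S\<^esub> = \<zero>\<^bsub>R\<^esub>"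
    by (simp_all add: component_module_def base_ring_def)
  have hom: "\<phi> \<in> right_module_hom ?S ?M (S.Free d)" and bij: "bij_betw \<phi> (A g) (carrier (S.Free d))"
    using phi by (auto simp: right_module_iso_def)
  define \<psi> where "\<psi> = inv_into (A g) \<phi>"
  have \<psi>: "\<psi> y \<in> A g" "\<phi> (\<psi> y) = y" if "y \<in> carrier (S.Free d)" for y
    using bij that by (auto simp: \<psi>_def bij_betw_def inv_into_into f_inv_into_f)
  have \<psi>\<phi>: "\<psi> (\<phi> x) = x" if "x \<in> A g" for x
    using bij that by (auto simp: \<psi>_def bij_betw_def)
  have \<phi>: "\<phi> x \<in> carrier (S.Free d)" if "x \<in> A g" for x
    using right_module_homD(1)[OF hom] that by simp
  have \<psi>_hom: "\<psi> \<in> right_module_hom ?S (S.Free d) ?M"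
  proof (rule right_module_homI)
    fix x assume x: "x \<in> carrier (S.Free d)"
    show "\<psi> x \<in> carrier ?M" using \<psi>(1)[OF x] by simp
    show "\<psi> (x \<oplus>\<^bsub>S.Free d\<^esub> y) = \<psi> x \<oplus>\<^bsub>?M\<^esub> \<psi> y" if y: "y \<in> carrier (S.Free d)" for y
    proof -
      have "\<phi> (\<psi> x \<oplus>\<^bsub>?M\<^esub> \<psi> y) = x \<oplus>\<^bsub>S.Free d\<^esub> y"
        using right_module_homD(2)[OF hom] \<psi>[OF x] \<psi>[OF y] by simp
      then show ?thesis
        using \<psi>\<phi>[of "\<psi> x \<oplus>\<^bsub>?M\<^esub> \<psi> y"] M.a_closed[of "\<psi> x" "\<psi> y"] \<psi>(1)[OF x] \<psi>(1)[OF y] by simp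
    qed
    show "\<psi> (s \<odot>\<^bsub>S.Free d\<^esub> x) = s \<odot>\<^bsub>?M\<^esub> \<psi> x" if s: "s \<in> carrier ?S" for s
    proof -
      have "\<phi> (s \<odot>\<^bsub>?M\<^esub> \<psi> x) = s \<odot>\<^bsub>S.Free d\<^esub> x"
        using right_module_homD(3)[OF hom] \<psi>[OF x] s by simp
      then show ?thesis
        using \<psi>\<phi>[of "s \<odot>\<^bsub>?M\<^esub> \<psi> x"] M.smult_closed[of s "\<psi> x"] \<psi>(1)[OF x] s by simp
    qed
  qed
  define u where "u s = \<psi> (unit_vector ?S d s)" for s
  define c where "c s x = \<phi> x s" for s :: nat and x
  have uA: "u s \<in> A g" for s
    using \<psi>(1)[OF S.unit_vector_closed] by (simp add: u_def)
  have cA: "c s x \<in> A \<one>\<^bsub>G\<^esub>" if "s < d" "x \<in> A g" for s x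
    using S.free_nth_closed[OF \<phi>[OF that(2)] that(1)] by (simp add: c_def)
  have act: "x \<otimes>\<^bsub>R\<^esub> a \<in> A g" if "x \<in> A g" "a \<in> A \<one>\<^bsub>G\<^esub>" for x a
    using M.smult_closed[of a x] that by simp
  have "x = (\<Oplus>\<^bsub>R\<^esub>s\<in>{..<d}. u s \<otimes>\<^bsub>R\<^esub> c s x)" if x: "x \<in> A g" for x
  proof -
    have "x = finsum ?M (\<lambda>s. u s \<otimes>\<^bsub>R\<^esub> c s x) {..<d}"
      using S.hom_from_free_module[OF M.right_module_axioms \<psi>_hom \<phi>[OF x]] \<psi>\<phi>[OF x]
      by (simp add: u_def c_def)
    also have "\<dots> = (\<Oplus>\<^bsub>R\<^esub>s\<in>{..<d}. u s \<otimes>\<^bsub>R\<^esub> c s x)"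
      by (rule additive_map_finsum[where h = "\<lambda>x. x", OF M.abelian_group_axioms R.abelian_group_axioms])
        (use component_sub[OF g] act uA cA[OF _ x] in auto)
    finally show ?thesis .
  qed
  moreover have "c s (x \<oplus>\<^bsub>R\<^esub> y) = c s x \<oplus>\<^bsub>R\<^esub> c s y" if "s < d" "x \<in> A g" "y \<in> A g" for s x y
    using right_module_homD(2)[OF hom, of x y] S.free_nth(1)[OF that(1)] that by (simp add: c_def)
  moreover have "c s (x \<otimes>\<^bsub>R\<^esub> a) = c s x \<otimes>\<^bsub>R\<^esub> a" if "s < d" "x \<in> A g" "a \<in> A \<one>\<^bsub>G\<^esub>" for s x a
    using right_module_homD(3)[OF hom, of x a] S.free_nth(2)[OF that(1)] that by (simp add: c_def)
  moreover have "c s (u t) = (if s = t then \<one>\<^bsub>R\<^esub> else \<zero>\<^bsub>R\<^esub>)" if "s < d" for s t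
    using \<psi>(2)[OF S.unit_vector_closed] S.free_nth(3)[OF that] by (simp add: c_def u_def)
  ultimately show ?thesis
    unfolding component_basis_def using uA cA by (intro exI[of _ u] exI[of _ c] conjI allI impI ballI) simp_all
qed

section \<open>Transfer of the unbounded generating number\<close>

text \<open>If \<open>R\<close> has no unbounded generating number, take \<open>P Q = 1\<close> over \<open>R\<close> with \<open>Q\<close> of size \<open>n \<times> 2 n r\<close>,
  and let \<open>K\<close> contain the degrees that occur in the entries of \<open>Q\<close>. For a finite set \<open>F\<close> of degrees,
  \<open>Q\<close> maps elements with degrees in \<open>F\<close> to elements with degrees in \<open>K F\<close>. Over the base ring, \<open>P\<close>
  therefore induces an epimorphism onto \<open>2 n r\<close> copies of the sum of the components in \<open>F\<close> from \<open>n\<close>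
  copies of the sum of those in \<open>K F\<close>. Comparing ranks, which lie between 1 and \<open>r\<close> on the support,
  yields the doubling.\<close>
lemma support_doubling:
  assumes r: "r > 0"
    and free: "\<And>g. g \<in> carrier G \<Longrightarrow> \<exists>i\<in>{0..r}. right_module_iso (base_ring G R A)
      (component_module R A g) (free_right_module (base_ring G R A) i) \<noteq> {}"
    and UGN: "UGN (base_ring G R A)" and not_UGN: "\<not> UGN R"
  shows "\<exists>K. finite K \<and> K \<subseteq> carrier G \<and> (\<forall>F. finite F \<longrightarrow> F \<subseteq> graded_support G R A \<longrightarrow>
    2 * card F \<le> card ((K <#>\<^bsub>G\<^esub> F) \<inter> graded_support G R A))"
proof -
  let ?X = "graded_support G R A"
  interpret S: ring "base_ring G R A" by (rule ring_base_ring)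
  have XG: "g \<in> carrier G" if "g \<in> ?X" for g
    using that by (simp add: graded_support_def)
  have AR: "x \<in> carrier R" if "x \<in> A g" "g \<in> carrier G" for x g
    using that component_sub by blast
  have "\<exists>d u c. d \<le> r \<and> component_basis g d u c" if g: "g \<in> carrier G" for g
  proof -
    obtain d \<phi> where d: "d \<le> r" and \<phi>: "\<phi> \<in> right_module_iso (base_ring G R A)
        (component_module R A g) (free_right_module (base_ring G R A) d)"
      using free[OF g] by auto
    show ?thesis
      using d component_basis_exists[OF g \<phi>] by blast
  qed
  then obtain d u c where basis: "\<And>g. g \<in> carrier G \<Longrightarrow> d g \<le> r \<and> component_basis g (d g) (u g) (c g)"
    by metis
  have d_le: "d g \<le> r" and u: "\<And>s. s < d g \<Longrightarrow> u g s \<in> A g"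
    and c: "\<And>s x. s < d g \<Longrightarrow> x \<in> A g \<Longrightarrow> c g s x \<in> A \<one>\<^bsub>G\<^esub>"
    and c_add: "\<And>s x y. s < d g \<Longrightarrow> x \<in> A g \<Longrightarrow> y \<in> A g \<Longrightarrow>
      c g s (x \<oplus>\<^bsub>R\<^esub> y) = c g s x \<oplus>\<^bsub>R\<^esub> c g s y"
    and c_mult: "\<And>s x a. s < d g \<Longrightarrow> x \<in> A g \<Longrightarrow> a \<in> A \<one>\<^bsub>G\<^esub> \<Longrightarrow>
      c g s (x \<otimes>\<^bsub>R\<^esub> a) = c g s x \<otimes>\<^bsub>R\<^esub> a"
    and dual: "\<And>s t. s < d g \<Longrightarrow> t < d g \<Longrightarrow> c g s (u g t) = (if s = t then \<one>\<^bsub>R\<^esub> else \<zero>\<^bsub>R\<^esub>)"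
    and expand: "\<And>x. x \<in> A g \<Longrightarrow> x = (\<Oplus>\<^bsub>R\<^esub>s\<in>{..<d g}. u g s \<otimes>\<^bsub>R\<^esub> c g s x)"
    if "g \<in> carrier G" for g
    using basis[OF that] unfolding component_basis_def by blast+
  have d_pos: "0 < d g" if g: "g \<in> ?X" for g
  proof (rule ccontr)
    assume "\<not> 0 < d g"
    then have "x = \<zero>\<^bsub>R\<^esub>" if "x \<in> A g" for x
      using expand[OF XG[OF g] that] by simp
    then have "A g = {\<zero>\<^bsub>R\<^esub>}"
      using component_zero[OF XG[OF g]] by blast
    with g show False by (simp add: graded_support_def)
  qed
  obtain n :: nat where n: "n > 0"
    and all: "\<And>m. n \<le> m \<Longrightarrow> right_invertible_matrix R {..<n} {..<m}"
    using R.not_UGN_imp_right_invertible_matrix[OF not_UGN] by blast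
  \<comment> \<open>One factor 2 for the doubling, the factor \<open>r\<close> to absorb the ranks of the components.\<close>
  define m where "m = 2 * n * r"
  have "n \<le> m" using r n by (simp add: m_def)
  then obtain P Q where PQ': "\<forall>j\<in>{..<m}. \<forall>i\<in>{..<n}. P j i \<in> carrier R \<and> Q i j \<in> carrier R"
    and id': "\<forall>j\<in>{..<m}. \<forall>j'\<in>{..<m}.
      (\<Oplus>\<^bsub>R\<^esub>i\<in>{..<n}. P j i \<otimes>\<^bsub>R\<^esub> Q i j') = (if j = j' then \<one>\<^bsub>R\<^esub> else \<zero>\<^bsub>R\<^esub>)"
    using all unfolding right_invertible_matrix_def by blast
  have PQ: "P j i \<in> carrier R" "Q i j \<in> carrier R" if "i \<in> {..<n}" "j \<in> {..<m}" for i j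
    using PQ' that by simp_all
  define K where "K = (\<Union>i\<in>{..<n}. \<Union>j\<in>{..<m}. homogeneous_support (Q i j))"
  have K: "finite K" "K \<subseteq> carrier G"
    unfolding K_def using homogeneous_part(2) PQ by (auto simp: homogeneous_support_def)
  define \<beta> where "\<beta> = (\<lambda>(g, s). u g s)"
  define \<gamma> where "\<gamma> = (\<lambda>(g, s) x. c g s (homogeneous_part x g))"
  let ?B = "SIGMA g:carrier G. {..<d g}"
  have \<beta>: "\<beta> b \<in> carrier R" if "b \<in> ?B" for b
    using that u AR by (force simp: \<beta>_def)
  have dbl: "2 * card F \<le> card ((K <#>\<^bsub>G\<^esub> F) \<inter> ?X)" if F: "finite F" "F \<subseteq> ?X" for F
  proof -
    let ?H = "(K <#>\<^bsub>G\<^esub> F) \<inter> ?X"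
    let ?E = "SIGMA g:F. {..<d g}" and ?E' = "SIGMA g:?H. {..<d g}"
    have "K <#>\<^bsub>G\<^esub> F = (\<lambda>(k, g). k \<otimes>\<^bsub>G\<^esub> g) ` (K \<times> F)"
      by (auto simp: set_mult_def)
    then have H: "finite ?H" using K F by simp
    have HG: "h \<in> carrier G" if "h \<in> ?H" for h using XG that by blast
    have finE: "finite ?E" "finite ?E'" using H F by (auto intro: finite_SigmaI)
    \<comment> \<open>The entries of \<open>Q\<close> map the span of \<open>?E\<close> into that of \<open>?E'\<close>: all degrees that occur lie in
      \<open>K F\<close>, and degrees outside of the support contribute nothing.\<close>
    have expandQ: "Q i j \<otimes>\<^bsub>R\<^esub> \<beta> b = (\<Oplus>\<^bsub>R\<^esub>e\<in>?E'. \<beta> e \<otimes>\<^bsub>R\<^esub> \<gamma> e (Q i j \<otimes>\<^bsub>R\<^esub> \<beta> b))"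
      if ij: "i \<in> {..<n}" "j \<in> {..<m}" and b: "b \<in> ?E" for i j b
    proof -
      obtain g s where gs: "b = (g, s)" "g \<in> F" "s < d g" using b by auto
      have g: "g \<in> carrier G" using gs F XG by blast
      let ?y = "Q i j \<otimes>\<^bsub>R\<^esub> \<beta> b"
      have bA: "\<beta> b \<in> A g" using u[OF g gs(3)] by (simp add: \<beta>_def gs)
      have y: "?y \<in> carrier R" using PQ[OF ij] AR[OF bA g] by simp
      have "homogeneous_support ?y \<subseteq> homogeneous_support (Q i j) <#>\<^bsub>G\<^esub> {g}"
        by (rule homogeneous_support_mult_component[OF PQ(2)[OF ij] g bA])
      also have "\<dots> \<subseteq> K <#>\<^bsub>G\<^esub> F"
        using ij gs(2) by (auto simp: K_def set_mult_def)
      finally have "homogeneous_support ?y \<subseteq> K <#>\<^bsub>G\<^esub> F" .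
      moreover have "homogeneous_support ?y \<subseteq> ?X"
        using homogeneous_part(1)[OF y] by (auto simp: homogeneous_support_def graded_support_def)
      ultimately have sub: "homogeneous_support ?y \<subseteq> ?H" by blast
      have yA: "homogeneous_part ?y h \<in> A h" if "h \<in> ?H" for h
        using homogeneous_part(1)[OF y HG[OF that]] .
      have summand: "u h t \<otimes>\<^bsub>R\<^esub> c h t (homogeneous_part ?y h) \<in> carrier R" if "h \<in> ?H" "t < d h" for h t
        using AR[OF u[OF HG[OF that(1)] that(2)] HG[OF that(1)]]
          AR[OF c[OF HG[OF that(1)] that(2) yA[OF that(1)]] G.one_closed] by simp
      have "?y = (\<Oplus>\<^bsub>R\<^esub>h\<in>?H. homogeneous_part ?y h)"
        by (rule sum_homogeneous_parts[OF y H _ sub]) (use HG in blast)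
      also have "\<dots> = (\<Oplus>\<^bsub>R\<^esub>h\<in>?H. \<Oplus>\<^bsub>R\<^esub>t\<in>{..<d h}. u h t \<otimes>\<^bsub>R\<^esub> c h t (homogeneous_part ?y h))"
      proof (rule R.finsum_cong')
        fix h assume h: "h \<in> ?H"
        show "homogeneous_part ?y h = (\<Oplus>\<^bsub>R\<^esub>t\<in>{..<d h}. u h t \<otimes>\<^bsub>R\<^esub> c h t (homogeneous_part ?y h))"
          by (rule expand[OF HG[OF h] yA[OF h]])
      qed (use summand in \<open>auto intro!: R.finsum_closed\<close>)
      also have "\<dots> = (\<Oplus>\<^bsub>R\<^esub>h\<in>?H. \<Oplus>\<^bsub>R\<^esub>t\<in>{..<d h}. \<beta> (h, t) \<otimes>\<^bsub>R\<^esub> \<gamma> (h, t) ?y)"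
        by (simp add: \<beta>_def \<gamma>_def)
      also have "\<dots> = (\<Oplus>\<^bsub>R\<^esub>e\<in>?E'. \<beta> e \<otimes>\<^bsub>R\<^esub> \<gamma> e ?y)"
        by (rule R.finsum_Sigma[symmetric]) (use H summand in \<open>auto simp: \<beta>_def \<gamma>_def\<close>)
      finally show ?thesis .
    qed
    have "right_invertible_matrix (R\<lparr>carrier := A \<one>\<^bsub>G\<^esub>\<rparr>) ({..<n} \<times> ?E') ({..<m} \<times> ?E)"
    proof (rule R.right_invertible_matrix_restrict_scalars[where B = ?B and u = \<beta> and c = \<gamma>
          and P = P and Q = Q, OF base_subring _ finE(2) _ _ PQ _ \<beta> _ _ _ _ expandQ])
      show "?E \<subseteq> ?B" "?E' \<subseteq> ?B" using F XG by auto
      show "(\<Oplus>\<^bsub>R\<^esub>i\<in>{..<n}. P j i \<otimes>\<^bsub>R\<^esub> Q i j') = (if j = j' then \<one>\<^bsub>R\<^esub> else \<zero>\<^bsub>R\<^esub>)"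
        if "j \<in> {..<m}" "j' \<in> {..<m}" for j j'
        using id' that by blast
      fix b assume "b \<in> ?B"
      then obtain g s where gs: "b = (g, s)" "g \<in> carrier G" "s < d g" by auto
      show "\<gamma> b x \<in> A \<one>\<^bsub>G\<^esub>" if "x \<in> carrier R" for x
        using c[OF gs(2,3) homogeneous_part(1)[OF that gs(2)]] by (simp add: \<gamma>_def gs(1))
      show "\<gamma> b (x \<oplus>\<^bsub>R\<^esub> y) = \<gamma> b x \<oplus>\<^bsub>R\<^esub> \<gamma> b y" if "x \<in> carrier R" "y \<in> carrier R" for x y
        using c_add[OF gs(2,3) homogeneous_part(1)[OF that(1) gs(2)] homogeneous_part(1)[OF that(2) gs(2)]]
          homogeneous_part_add[OF that gs(2)] by (simp add: \<gamma>_def gs(1))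
      show "\<gamma> b (x \<otimes>\<^bsub>R\<^esub> a) = \<gamma> b x \<otimes>\<^bsub>R\<^esub> a" if "x \<in> carrier R" "a \<in> A \<one>\<^bsub>G\<^esub>" for x a
        using c_mult[OF gs(2,3) homogeneous_part(1)[OF that(1) gs(2)] that(2)]
          homogeneous_part_mult_base[OF that gs(2)] by (simp add: \<gamma>_def gs(1))
      fix b' assume "b' \<in> ?B"
      then obtain h t where ht: "b' = (h, t)" "h \<in> carrier G" "t < d h" by auto
      have part: "homogeneous_part (u h t) g = (if g = h then u h t else \<zero>\<^bsub>R\<^esub>)"
        by (rule homogeneous_part_of_component[OF ht(2) u[OF ht(2,3)] gs(2)])
      have zero: "c g s \<zero>\<^bsub>R\<^esub> = \<zero>\<^bsub>R\<^esub>"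
        using c_mult[OF gs(2,3) component_zero[OF gs(2)] component_zero[OF G.one_closed]]
          AR[OF c[OF gs(2,3) component_zero[OF gs(2)]] G.one_closed] by simp
      show "\<gamma> b (\<beta> b') = (if b = b' then \<one>\<^bsub>R\<^esub> else \<zero>\<^bsub>R\<^esub>)"
        using part zero dual[OF gs(2,3)] ht(3) by (auto simp: \<beta>_def \<gamma>_def gs(1) ht(1))
    qed auto
    then have "card ({..<m} \<times> ?E) \<le> card ({..<n} \<times> ?E')"
      using S.UGN_card_le[OF UGN, of "{..<n} \<times> ?E'" "{..<m} \<times> ?E"] finE
      by (simp add: base_ring_def)
    then have le: "m * (\<Sum>g\<in>F. d g) \<le> n * (\<Sum>h\<in>?H. d h)"
      using H F by (simp add: card_cartesian_product card_SigmaI)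
    have "card F \<le> (\<Sum>g\<in>F. d g)"
      using sum_mono[of F "\<lambda>_. 1" d] d_pos F by (force simp: Suc_le_eq)
    then have "m * card F \<le> m * (\<Sum>g\<in>F. d g)" by simp
    also note le
    also have "n * (\<Sum>h\<in>?H. d h) \<le> n * (card ?H * r)"
      using sum_bounded_above[of ?H d r] d_le HG by (intro mult_le_mono2) auto
    finally have "(n * r) * (2 * card F) \<le> (n * r) * card ?H"
      by (simp add: m_def ac_simps)
    then show ?thesis
      using n r by (subst (asm) mult_le_cancel1) simp
  qed
  show ?thesis
    using K dbl by (intro exI[of _ K]) simp
qed

end

theorem theoremA:
  fixes G :: "('g, 'm) monoid_scheme" and R :: "('a, 'n) ring_scheme" and A :: "'g \<Rightarrow> 'a set"
  assumes "graded_ring G R A"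
    and "\<exists>r::nat. r > 0 \<and> (\<forall>g\<in>carrier G. \<exists>i\<in>{0..r}.
           right_module_iso (base_ring G R A) (component_module R A g)
             (free_right_module (base_ring G R A) i) \<noteq> {})"
    and "amenable_wrt G (graded_support G R A)"
  shows "UGN R \<longleftrightarrow> UGN (base_ring G R A)"
proof
  interpret graded_ring G R A by fact
  interpret S: ring "base_ring G R A" by (rule ring_base_ring)
  show "UGN (base_ring G R A)" if "UGN R"
  proof -
    have "right_invertible_matrix R {..<n} {..<Suc n}"
      if "right_invertible_matrix (base_ring G R A) {..<n} {..<Suc n}" for n :: nat
      using R.right_invertible_matrix_of_subring[OF base_subring that[unfolded base_ring_def]] .
    with \<open>UGN R\<close> show ?thesis
      unfolding R.UGN_iff S.UGN_iff by blast
  qed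
  show "UGN R" if UGN: "UGN (base_ring G R A)"
  proof (rule ccontr)
    assume "\<not> UGN R"
    obtain r :: nat where r: "r > 0" and free: "\<And>g. g \<in> carrier G \<Longrightarrow>
        \<exists>i\<in>{0..r}. right_module_iso (base_ring G R A) (component_module R A g)
          (free_right_module (base_ring G R A) i) \<noteq> {}"
      using assms(2) by blast
    obtain K where K: "finite K" "K \<subseteq> carrier G"
      and dbl: "\<forall>F. finite F \<longrightarrow> F \<subseteq> graded_support G R A \<longrightarrow>
        2 * card F \<le> card ((K <#>\<^bsub>G\<^esub> F) \<inter> graded_support G R A)"
      using support_doubling[OF r free UGN \<open>\<not> UGN R\<close>] by blast
    show False
      by (rule G.amenable_no_doubling[OF assms(3) K]) (use dbl in blast)
  qed
qed

end
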